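(* Let $d\ge 1$, $p>1$, let $J$ be an admissible interaction kernel on $\mathbb{Z}^d$ with tail index $\alpha\in(0,\infty]$, and let $\alpha'=\alpha/2$ if $\alpha\in(0,2)$ and $\alpha'=1$ if $\alpha\in[2,\infty]$. If $p\ge 1+\frac{4\alpha'}{d}$, then $\nu_0>0$. If $\nu>\nu_0$, then $I_\nu<0$ and $I_\nu$ has a minimizer. Conversely, if $0<\nu<\nu_0$, then $I_\nu=0$ and no minimizer exists.
   Context: $|n|$ denotes the $l^1$ norm of $n\in\mathbb{Z}^d$, and $S_k=\{n\in\mathbb{Z}^d:|n|=k\}$. An admissible interaction kernel with tail index $\alpha\in(0,\infty]$ is a function $J:\mathbb{Z}^d\to[0,\infty)$ with $J_0=0$, $J_n=J_{-n}$ for all $n$, and $\overline{J}:=\sum_m J_m<\infty$, for which there is an envelope $\eta:\mathbb{N}\to[0,\infty)$ such that: if $\alpha<\infty$, there exist $0<C_1<C_2$ and $k_0\in\mathbb{N}$ with $C_1\le k^{d+\alpha}\eta(k)\le C_2$ for all $k\ge k_0$; if $\alpha=\infty$, $\lim_{k\to\infty}k^{d+\beta}\eta(k)=0$ for every $\beta<\infty$; and moreover (I) there exist $R,c_\pm>0$ such that $J_n\le c_+\eta(|n|)$ whenever $|n|\ge R$, and $\sum_{m\in S_k}J_m\ge c_-k^{d-1}\eta(k)$ whenever $k\ge R$; (II) $\min_{m\in S_1}J_m>0$. For $u\in l^2(\mathbb{Z}^d)$ (complex-valued) let $(Lu)_n=\sum_{m\ne n}J_{n-m}(u_n-u_m)$,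 $M[u]=\|u\|_{l^2}^2$, and $H[u]=\frac12\langle Lu,u\rangle-\frac{1}{p+1}\|u\|_{l^{p+1}}^{p+1}$. For $\nu>0$ let $I_\nu=\inf\{H[q]:q\in l^2(\mathbb{Z}^d),\ M[q]=\nu\}$; a minimizer of $I_\nu$ is a $q$ with $M[q]=\nu$ and $H[q]=I_\nu$. The excitation threshold is $$\nu_0=\sup\Big\{\nu>0:\ \|q\|_{l^{p+1}}^{p+1}\le\tfrac{p+1}{2}\nu^{-\frac{p-1}{2}}\|q\|_{l^2}^{p-1}\langle Lq,q\rangle\ \ \forall q\in l^2(\mathbb{Z}^d)\Big\}\ge 0,$$ with $\nu_0=0$ if the set is empty. Equivalently $\nu_0=(\frac{p+1}{2}K)^{2/(p-1)}$ with $K=\inf_{u\ne0}\|u\|_{l^2}^{p-1}\langle Lu,u\rangle/\|u\|_{l^{p+1}}^{p+1}$. *)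

theory Defs
  imports "HOL-Analysis.Analysis"
begin

text \<open>The lattice is the type \<^typ>\<open>int ^ 'd\<close>, so the dimension is \<open>CARD('d)\<close>.\<close>

definition l1_norm :: "int ^ 'd::finite \<Rightarrow> nat" where
  "l1_norm n = (\<Sum>i\<in>UNIV. nat \<bar>n $ i\<bar>)"

definition l1_sphere :: "nat \<Rightarrow> (int ^ 'd::finite) set" where
  "l1_sphere k = {n. l1_norm n = k}"

text \<open>Finiteness and nonemptiness ensure that the sums over spheres and the minimum over the
  unit sphere in the definition of admissibility are not degenerate.\<close>

lemma finite_l1_sphere: "finite (l1_sphere k :: (int ^ 'd::finite) set)"
proof (rule finite_subset)
  show "(l1_sphere k :: (int ^ 'd) set) \<subseteq> vec_lambda ` (UNIV \<rightarrow>\<^sub>E {- int k..int k})"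
  proof
    fix n :: "int ^ 'd"
    assume "n \<in> l1_sphere k"
    then have sum: "(\<Sum>i\<in>UNIV. nat \<bar>n $ i\<bar>) = k"
      by (simp add: l1_sphere_def l1_norm_def)
    have "n $ i \<in> {- int k..int k}" for i
    proof -
      have "nat \<bar>n $ i\<bar> \<le> (\<Sum>i\<in>UNIV. nat \<bar>n $ i\<bar>)"
        by (rule member_le_sum) auto
      then have "nat \<bar>n $ i\<bar> \<le> k"
        by (simp only: sum)
      then show ?thesis
        by auto
    qed
    then have "vec_nth n \<in> UNIV \<rightarrow>\<^sub>E {- int k..int k}"
      by auto
    then show "n \<in> vec_lambda ` (UNIV \<rightarrow>\<^sub>E {- int k..int k})"
      by (metis image_eqI vec_nth_inverse)
  qed
  show "finite (vec_lambda ` ((UNIV :: 'd set) \<rightarrow>\<^sub>E {- int k..int k}))"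
    by (intro finite_imageI finite_PiE) auto
qed

lemma l1_sphere_nonempty: "(l1_sphere k :: (int ^ 'd::finite) set) \<noteq> {}"
proof -
  have "nat \<bar>axis j (int k) $ i\<bar> = (if i = j then k else 0)" for i j :: 'd
    by (simp add: axis_def)
  then have "l1_norm (axis j (int k) :: int ^ 'd) = k" for j :: 'd
    by (simp add: l1_norm_def)
  then show ?thesis
    by (auto simp: l1_sphere_def)
qed

definition admissible_kernel :: "ereal \<Rightarrow> (int ^ 'd::finite \<Rightarrow> real) \<Rightarrow> bool" where
  "admissible_kernel \<alpha> J \<longleftrightarrow>
     0 < \<alpha> \<and>
     (\<forall>n. 0 \<le> J n) \<and> J 0 = 0 \<and> (\<forall>n. J (- n) = J n) \<and> J summable_on UNIV \<and>
     (\<exists>\<eta> :: nat \<Rightarrow> real.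
        (\<forall>k. 0 \<le> \<eta> k) \<and>
        (\<alpha> < \<infinity> \<longrightarrow>
           (\<exists>C1 C2 k0. 0 < C1 \<and> C1 < C2 \<and>
              (\<forall>k\<ge>k0. C1 \<le> real k powr (real CARD('d) + real_of_ereal \<alpha>) * \<eta> k \<and>
                       real k powr (real CARD('d) + real_of_ereal \<alpha>) * \<eta> k \<le> C2))) \<and>
        (\<alpha> = \<infinity> \<longrightarrow>
           (\<forall>\<beta> :: real. (\<lambda>k. real k powr (real CARD('d) + \<beta>) * \<eta> k) \<longlonglongrightarrow> 0)) \<and>
        (\<exists>R c_plus c_minus :: real. 0 < R \<and> 0 < c_plus \<and> 0 < c_minus \<and>
           (\<forall>n. R \<le> real (l1_norm n) \<longrightarrow> J n \<le> c_plus * \<eta> (l1_norm n)) \<and>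
           (\<forall>k. R \<le> real k \<longrightarrow>
              c_minus * real k ^ (CARD('d) - 1) * \<eta> k \<le> (\<Sum>m\<in>l1_sphere k. J m)))) \<and>
     0 < Min (J ` l1_sphere 1)"

definition alpha_prime :: "ereal \<Rightarrow> real" where
  "alpha_prime \<alpha> = (if \<alpha> < 2 then real_of_ereal \<alpha> / 2 else 1)"

definition ell2 :: "('a \<Rightarrow> complex) set" where
  "ell2 = {u. (\<lambda>n. (cmod (u n))\<^sup>2) summable_on UNIV}"

text \<open>On \<^const>\<open>ell2\<close> all the infinite sums below converge absolutely when \<open>r \<ge> 2\<close> and \<open>J\<close> is
  summable, so the default value 0 of \<^const>\<open>infsum\<close> is never used.\<close>

definition lp_norm :: "real \<Rightarrow> ('a \<Rightarrow> complex) \<Rightarrow> real" where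
  "lp_norm r u = (\<Sum>\<^sub>\<infinity>n. cmod (u n) powr r) powr (1 / r)"

definition ell2_inner :: "('a \<Rightarrow> complex) \<Rightarrow> ('a \<Rightarrow> complex) \<Rightarrow> complex" where
  "ell2_inner u v = (\<Sum>\<^sub>\<infinity>n. u n * cnj (v n))"

definition lattice_op ::
    "(int ^ 'd::finite \<Rightarrow> real) \<Rightarrow> (int ^ 'd \<Rightarrow> complex) \<Rightarrow> int ^ 'd \<Rightarrow> complex" where
  "lattice_op J u n = (\<Sum>\<^sub>\<infinity>m\<in>UNIV - {n}. of_real (J (n - m)) * (u n - u m))"

text \<open>For symmetric \<open>J\<close> the operator is self-adjoint, so the inner product below is real and
  \<^const>\<open>Re\<close> only changes its type.\<close>

definition lattice_form :: "(int ^ 'd::finite \<Rightarrow> real) \<Rightarrow> (int ^ 'd \<Rightarrow> complex) \<Rightarrow> real" where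
  "lattice_form J u = Re (ell2_inner (lattice_op J u) u)"

definition mass :: "('a \<Rightarrow> complex) \<Rightarrow> real" where
  "mass u = (lp_norm 2 u)\<^sup>2"

definition energy ::
    "(int ^ 'd::finite \<Rightarrow> real) \<Rightarrow> real \<Rightarrow> (int ^ 'd \<Rightarrow> complex) \<Rightarrow> real" where
  "energy J p u = lattice_form J u / 2 - lp_norm (p + 1) u powr (p + 1) / (p + 1)"

text \<open>For \<open>\<nu> > 0\<close> and \<open>p > 1\<close> the set of energies is nonempty and bounded below (by
  \<open>- \<nu> powr ((p + 1) / 2) / (p + 1)\<close>), so the real-valued infimum is the genuine one.\<close>

definition ground_energy :: "(int ^ 'd::finite \<Rightarrow> real) \<Rightarrow> real \<Rightarrow> real \<Rightarrow> real" where
  "ground_energy J p \<nu> = Inf {energy J p q | q. q \<in> ell2 \<and> mass q = \<nu>}"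

definition is_minimizer ::
    "(int ^ 'd::finite \<Rightarrow> real) \<Rightarrow> real \<Rightarrow> real \<Rightarrow> (int ^ 'd \<Rightarrow> complex) \<Rightarrow> bool" where
  "is_minimizer J p \<nu> q \<longleftrightarrow> q \<in> ell2 \<and> mass q = \<nu> \<and> energy J p q = ground_energy J p \<nu>"

definition threshold_set :: "(int ^ 'd::finite \<Rightarrow> real) \<Rightarrow> real \<Rightarrow> real set" where
  "threshold_set J p = {\<nu>. 0 < \<nu> \<and>
     (\<forall>q\<in>ell2. lp_norm (p + 1) q powr (p + 1)
        \<le> (p + 1) / 2 * \<nu> powr (- (p - 1) / 2) * lp_norm 2 q powr (p - 1) * lattice_form J q)}"

text \<open>Testing with a unit point mass shows that the set is bounded above when \<open>p > 1\<close>, so the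
  real-valued supremum is the genuine one.\<close>

definition excitation_threshold :: "(int ^ 'd::finite \<Rightarrow> real) \<Rightarrow> real \<Rightarrow> real" where
  "excitation_threshold J p =
     (if threshold_set J p = {} then 0 else Sup (threshold_set J p))"

end

theory Submission
  imports Defs "HOL-Complex_Analysis.Great_Picard" "HOL-Real_Asymp.Real_Asymp"
begin

text \<open>Summation by parts turns \<open>\<langle>Lu, u\<rangle>\<close> into \<open>\<Sum>\<^sub>h J h \<parallel>u - u(\<cdot> + h)\<parallel>\<^sup>2 / 2\<close>. The threshold is positive
  because of a Gagliardo--Nirenberg inequality, which is obtained without Fourier analysis:
  \<open>v n\<close> is compared with averages of \<open>v\<close> over a region of diameter \<open>K\<close>, where \<open>v\<close> is a dyadic
  truncation of \<open>\<bar>u\<bar>\<close> and \<open>K\<close> is chosen so large that the average is small on the level set; the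
  resulting bounds for the level sets sum up because the Dirichlet forms of the truncations do.
  Below the threshold the energy is positive, while normalised indicators of large cubes show that
  its infimum is zero. Above the threshold a scaled violator of the inequality has negative energy.
  A minimizing sequence then does not vanish in the supremum norm, so its translates converge
  pointwise along a subsequence to some \<open>q \<noteq> 0\<close>; mass and energy split asymptotically into those
  of \<open>q\<close> and of the remainder (Brezis--Lieb), and any loss of mass would cost energy.\<close>

section \<open>Square-summable functions\<close>

text \<open>A single length scale produces the exponent. Let \<open>M\<close> be the mass,
  \<open>Q\<close> the Dirichlet form, \<open>d\<close> the dimension and \<gamma> = 2 \<alpha>',
  which is the minimum of \<alpha> and 2. Averaging at scale \<open>K\<close> bounds the mean square
  by order \<open>M / K ^ d\<close>, while comparing a function with its average costs
  \<open>K powr \<gamma> * Q\<close>. On the set where the modulus is at least \<open>t\<close>, the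
  choice of \<open>K ^ d\<close> of order \<open>M / t^2\<close> makes the average negligible, and
  the cardinality of that set times \<open>t powr (2 + 2 * \<gamma> / d)\<close> is at most a
  constant times \<open>M powr (\<gamma> / d) * Q\<close>. The power of \<open>t\<close> is p + 1
  for p = 1 + 4 \<alpha>' / d; larger p follow because the supremum on a lattice is at most the
  square root of the mass. There are two obstacles. The estimate is of weak type: with
  \<open>Q\<close> of the whole function on the right, infinitely many dyadic levels could not be
  summed, so each level must be charged to its own layer of values. And away from the unit sphere
  \<open>J\<close> is bounded below only through its sums over spheres, so there is no pointwise
  comparison with a model kernel.\<close>

lemma mass_eq: "mass u = (\<Sum>\<^sub>\<infinity>n. (cmod (u n))\<^sup>2)"
proof -
  have "0 \<le> (\<Sum>\<^sub>\<infinity>n. (cmod (u n))\<^sup>2)"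
    by (intro infsum_nonneg) auto
  moreover have "(\<lambda>n. cmod (u n) powr 2) = (\<lambda>n. (cmod (u n))\<^sup>2)"
    by auto
  ultimately show ?thesis
    unfolding mass_def lp_norm_def by (simp add: powr_half_sqrt)
qed

lemma mass_nonneg: "0 \<le> mass u"
  by (simp add: mass_def)

lemma ell2_summable: "u \<in> ell2 \<Longrightarrow> (\<lambda>n. (cmod (u n))\<^sup>2) summable_on UNIV"
  by (simp add: ell2_def)

lemma ell2_if_finite_support: "finite {n. u n \<noteq> 0} \<Longrightarrow> u \<in> ell2"
  using summable_on_cong_neutral[of "UNIV" "{n. u n \<noteq> 0}" "\<lambda>n. (cmod (u n))\<^sup>2" "\<lambda>n. (cmod (u n))\<^sup>2"]
  by (simp add: ell2_def)

lemma sum_norm_sq_le_mass: "u \<in> ell2 \<Longrightarrow> finite F \<Longrightarrow> (\<Sum>n\<in>F. (cmod (u n))\<^sup>2) \<le> mass u"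
  unfolding mass_eq by (rule finite_sum_le_infsum) (auto simp: ell2_summable)

lemma norm_sq_le_mass: "u \<in> ell2 \<Longrightarrow> (cmod (u n))\<^sup>2 \<le> mass u"
  using sum_norm_sq_le_mass[of u "{n}"] by simp

lemma mass_pos: "u \<in> ell2 \<Longrightarrow> u n \<noteq> 0 \<Longrightarrow> 0 < mass u"
  by (rule less_le_trans[OF _ norm_sq_le_mass[of u n]]) auto

lemma norm_add_sq_le: "(norm (a + b))\<^sup>2 \<le> 2 * (norm a)\<^sup>2 + 2 * (norm b)\<^sup>2"
  for a b :: "'a::real_normed_vector"
proof -
  have "(norm (a + b))\<^sup>2 \<le> (norm a + norm b)\<^sup>2"
    by (intro power_mono norm_triangle_ineq) auto
  also have "\<dots> \<le> 2 * (norm a)\<^sup>2 + 2 * (norm b)\<^sup>2"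
    using sum_squares_bound[of "norm a" "norm b"] by (simp add: power2_sum)
  finally show ?thesis .
qed

lemma norm_diff_sq_le: "(norm (a - b))\<^sup>2 \<le> 2 * (norm a)\<^sup>2 + 2 * (norm b)\<^sup>2"
  for a b :: "'a::real_normed_vector"
  using norm_add_sq_le[of a "- b"] by simp

lemma ell2_mono:
  assumes "u \<in> ell2" "\<And>n. cmod (v n) \<le> cmod (u n)"
  shows "v \<in> ell2" "mass v \<le> mass u"
proof -
  have le: "(cmod (v n))\<^sup>2 \<le> (cmod (u n))\<^sup>2" for n
    using assms(2) by (simp add: power_mono)
  show v: "v \<in> ell2"
    unfolding ell2_def mem_Collect_eq
    by (rule summable_on_comparison_test[OF ell2_summable[OF assms(1)]]) (use le in auto)
  show "mass v \<le> mass u"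
    unfolding mass_eq by (intro infsum_mono ell2_summable v assms(1) le)
qed

lemma ell2_diff:
  assumes "u \<in> ell2" "v \<in> ell2"
  shows "(\<lambda>n. u n - v n) \<in> ell2" "mass (\<lambda>n. u n - v n) \<le> 2 * mass u + 2 * mass v"
proof -
  have s: "(\<lambda>n. 2 * (cmod (u n))\<^sup>2 + 2 * (cmod (v n))\<^sup>2) summable_on UNIV"
    by (intro summable_on_add summable_on_cmult_right ell2_summable assms)
  show w: "(\<lambda>n. u n - v n) \<in> ell2"
    unfolding ell2_def mem_Collect_eq
    by (rule summable_on_comparison_test[OF s]) (auto intro: norm_diff_sq_le)
  have "mass (\<lambda>n. u n - v n) \<le> (\<Sum>\<^sub>\<infinity>n. 2 * (cmod (u n))\<^sup>2 + 2 * (cmod (v n))\<^sup>2)"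
    unfolding mass_eq by (intro infsum_mono s ell2_summable[OF w] norm_diff_sq_le)
  also have "\<dots> = 2 * mass u + 2 * mass v"
    unfolding mass_eq
    by (simp add: infsum_add infsum_cmult_right' summable_on_cmult_right ell2_summable assms)
  finally show "mass (\<lambda>n. u n - v n) \<le> 2 * mass u + 2 * mass v" .
qed

lemma ell2_cmult: "u \<in> ell2 \<Longrightarrow> (\<lambda>n. c * u n) \<in> ell2"
  by (simp add: ell2_def norm_mult power_mult_distrib summable_on_cmult_right)

lemma mass_cmult: "mass (\<lambda>n. c * u n) = (cmod c)\<^sup>2 * mass u"
  by (simp add: mass_eq norm_mult power_mult_distrib infsum_cmult_right')

lemma mult_le_sum_power2: "x * y \<le> x\<^sup>2 + y\<^sup>2" if "0 \<le> x" "0 \<le> y" for x y :: real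
  using sum_squares_bound[of x y] mult_nonneg_nonneg[OF that] by simp

lemma ell2_mult_summable:
  assumes "u \<in> ell2" "v \<in> ell2"
  shows "(\<lambda>n. cmod (u n) * cmod (v n)) summable_on UNIV"
proof (rule summable_on_comparison_test)
  show "(\<lambda>n. (cmod (u n))\<^sup>2 + (cmod (v n))\<^sup>2) summable_on UNIV"
    by (intro summable_on_add ell2_summable assms)
  show "cmod (u n) * cmod (v n) \<le> (cmod (u n))\<^sup>2 + (cmod (v n))\<^sup>2" for n
    by (simp add: mult_le_sum_power2)
qed auto

lemma infsum_mult_le_mass:
  assumes "u \<in> ell2" "v \<in> ell2"
  shows "(\<Sum>\<^sub>\<infinity>n. cmod (u n) * cmod (v n)) \<le> mass u + mass v"
proof -
  have "(\<Sum>\<^sub>\<infinity>n. cmod (u n) * cmod (v n)) \<le> (\<Sum>\<^sub>\<infinity>n. (cmod (u n))\<^sup>2 + (cmod (v n))\<^sup>2)"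
  proof (intro infsum_mono ell2_mult_summable summable_on_add ell2_summable assms)
    show "cmod (u n) * cmod (v n) \<le> (cmod (u n))\<^sup>2 + (cmod (v n))\<^sup>2" for n
      by (simp add: mult_le_sum_power2)
  qed
  then show ?thesis
    by (simp add: mass_eq infsum_add ell2_summable assms)
qed

section \<open>Tails of sums, weak convergence and dominated convergence\<close>

lemma infsum_tail_approx:
  fixes f :: "'a \<Rightarrow> real"
  assumes "f summable_on UNIV" "0 < e"
  obtains F where "finite F" "\<And>G. F \<subseteq> G \<Longrightarrow> \<bar>infsum f (- G)\<bar> \<le> e"
proof -
  have "\<exists>F. finite F \<and> F \<subseteq> UNIV \<and> dist (\<Sum>x\<in>F. \<bar>f x\<bar>) (\<Sum>\<^sub>\<infinity>x. \<bar>f x\<bar>) \<le> e"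
    using assms by (intro infsum_finite_approximation)
      (simp_all flip: summable_on_iff_abs_summable_on_real[unfolded real_norm_def])
  then obtain F where F: "finite F" "dist (\<Sum>x\<in>F. \<bar>f x\<bar>) (\<Sum>\<^sub>\<infinity>x. \<bar>f x\<bar>) \<le> e"
    by blast
  have abs: "(\<lambda>x. \<bar>f x\<bar>) summable_on A" for A
    using assms(1) summable_on_subset[of f UNIV A]
    by (simp flip: summable_on_iff_abs_summable_on_real[unfolded real_norm_def])
  have "\<bar>infsum f (- G)\<bar> \<le> e" if "F \<subseteq> G" for G
  proof -
    have "\<bar>infsum f (- G)\<bar> \<le> (\<Sum>\<^sub>\<infinity>x\<in>- G. \<bar>f x\<bar>)"
      using norm_infsum_bound[of f "- G"] abs by simp
    also have "\<dots> \<le> (\<Sum>\<^sub>\<infinity>x\<in>- F. \<bar>f x\<bar>)"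
      by (rule infsum_mono2) (use abs that in auto)
    also have "\<dots> = (\<Sum>\<^sub>\<infinity>x. \<bar>f x\<bar>) - (\<Sum>x\<in>F. \<bar>f x\<bar>)"
      using infsum_Un_disjoint[OF abs abs, of F "- F"] F(1) by simp
    also have "\<dots> \<le> e"
      using F(2) by (simp add: dist_real_def)
    finally show ?thesis .
  qed
  with F(1) show thesis
    using that by blast
qed

lemma infsum_split_finite:
  fixes f :: "'a \<Rightarrow> real"
  assumes "f summable_on UNIV" "finite F"
  shows "infsum f UNIV = sum f F + infsum f (- F)"
  using infsum_Un_disjoint[of f F "- F"] summable_on_subset[OF assms(1)] assms(2) by simp

text \<open>Bounded mass and pointwise convergence give weak convergence, here even with absolute
  values: a finite set carries almost all of \<open>a\<close> and there pointwise convergence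
  suffices; outside it the small tail of \<open>a\<close> is weighed against the bounded mass of
  \<open>r k\<close>.\<close>

lemma weak_pairing_tendsto_0:
  assumes a: "a \<in> ell2" and r: "\<And>k. r k \<in> ell2" "\<And>k. mass (r k) \<le> C"
    and lim: "\<And>n. (\<lambda>k. r k n) \<longlonglongrightarrow> 0"
  shows "(\<lambda>k. \<Sum>\<^sub>\<infinity>n. cmod (a n) * cmod (r k n)) \<longlonglongrightarrow> 0"
proof (rule tendstoI)
  fix e :: real
  assume e: "0 < e"
  have C: "0 \<le> C"
    using r(2)[of 0] mass_nonneg[of "r 0"] by linarith
  \<comment> \<open>The weight in Young's inequality off \<open>F\<close>: the tail of
    \<open>a\<close> then contributes e/4 and \<open>r k\<close> at most \<open>C / (2 * t)\<close>,
    which is below e/4.\<close>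
  define t where "t = (C + 1) * 2 / e"
  have t: "0 < t" "C / t < e / 2"
    using e C by (auto simp: t_def field_simps)
  obtain F where F: "finite F" "\<bar>\<Sum>\<^sub>\<infinity>n\<in>- F. (cmod (a n))\<^sup>2\<bar> \<le> e / (2 * t)"
    using infsum_tail_approx[OF ell2_summable[OF a], of "e / (2 * t)"] e t by (metis divide_pos_pos mult_pos_pos subset_refl zero_less_numeral)
  have "(\<lambda>k. \<Sum>n\<in>F. cmod (a n) * cmod (r k n)) \<longlonglongrightarrow> (\<Sum>n\<in>F. cmod (a n) * cmod 0)"
    by (intro tendsto_intros lim)
  then have "\<forall>\<^sub>F k in sequentially. (\<Sum>n\<in>F. cmod (a n) * cmod (r k n)) < e / 2"
    using e by (intro order_tendstoD(2)[of _ 0]) auto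
  then show "\<forall>\<^sub>F k in sequentially. dist (\<Sum>\<^sub>\<infinity>n. cmod (a n) * cmod (r k n)) 0 < e"
  proof eventually_elim
    case (elim k)
    have s: "(\<lambda>n. cmod (a n) * cmod (r k n)) summable_on A" for A
      using ell2_mult_summable[OF a r(1)] summable_on_subset by blast
    have sa: "(\<lambda>n. (cmod (a n))\<^sup>2) summable_on A" for A
      using ell2_summable[OF a] summable_on_subset by blast
    have sr: "(\<lambda>n. (cmod (r k n))\<^sup>2) summable_on A" for A
      using ell2_summable[OF r(1)] summable_on_subset by blast
    have "(\<Sum>\<^sub>\<infinity>n\<in>- F. cmod (a n) * cmod (r k n))
        \<le> (\<Sum>\<^sub>\<infinity>n\<in>- F. (t / 2) * (cmod (a n))\<^sup>2 + (1 / (2 * t)) * (cmod (r k n))\<^sup>2)"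
    proof (intro infsum_mono s summable_on_add summable_on_cmult_right sa sr)
      fix n
      have "0 \<le> (t * cmod (a n) - cmod (r k n))\<^sup>2 / (2 * t)"
        using t by simp
      also have "\<dots> = (t / 2) * (cmod (a n))\<^sup>2 + (1 / (2 * t)) * (cmod (r k n))\<^sup>2 - cmod (a n) * cmod (r k n)"
        using t by (simp add: power2_eq_square field_simps)
      finally show "cmod (a n) * cmod (r k n) \<le> (t / 2) * (cmod (a n))\<^sup>2 + (1 / (2 * t)) * (cmod (r k n))\<^sup>2"
        by simp
    qed
    also have "\<dots> = (t / 2) * (\<Sum>\<^sub>\<infinity>n\<in>- F. (cmod (a n))\<^sup>2) + (1 / (2 * t)) * (\<Sum>\<^sub>\<infinity>n\<in>- F. (cmod (r k n))\<^sup>2)"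
      by (simp only: infsum_add summable_on_cmult_right sa sr infsum_cmult_right')
    also have "\<dots> \<le> (t / 2) * (e / (2 * t)) + (1 / (2 * t)) * C"
    proof (intro add_mono mult_left_mono)
      have "(\<Sum>\<^sub>\<infinity>n\<in>- F. (cmod (r k n))\<^sup>2) \<le> mass (r k)"
        unfolding mass_eq by (rule infsum_mono2) (auto intro: sr)
      then show "(\<Sum>\<^sub>\<infinity>n\<in>- F. (cmod (r k n))\<^sup>2) \<le> C"
        using r(2)[of k] by linarith
    qed (use F t in auto)
    also have "\<dots> \<le> e / 2"
      using t e by (simp add: field_simps)
    finally have "(\<Sum>\<^sub>\<infinity>n. cmod (a n) * cmod (r k n)) < e"
      using elim infsum_split_finite[OF s F(1)] by linarith
    moreover have "0 \<le> (\<Sum>\<^sub>\<infinity>n. cmod (a n) * cmod (r k n))"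
      by (intro infsum_nonneg) auto
    ultimately show ?case
      by (simp add: dist_real_def)
  qed
qed

text \<open>Dominated convergence with majorant \<open>C * J\<close>. Summability of
  \<open>J\<close> is what tames the infinite range of the interaction: limits need only be taken
  for each fixed jump \<open>h\<close>.\<close>

lemma tannery:
  fixes J :: "'a \<Rightarrow> real" and f :: "nat \<Rightarrow> 'a \<Rightarrow> real"
  assumes J: "J summable_on UNIV" "\<And>h. 0 \<le> J h"
    and f: "\<And>k h. \<bar>f k h\<bar> \<le> C" and lim: "\<And>h. (\<lambda>k. f k h) \<longlonglongrightarrow> 0"
  shows "(\<lambda>k. \<Sum>\<^sub>\<infinity>h. J h * f k h) \<longlonglongrightarrow> 0"
proof (rule tendstoI)
  fix e :: real
  assume e: "0 < e"
  have C: "0 \<le> C"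
    using f[of 0 undefined] by linarith
  have sJ: "J summable_on A" for A
    using J(1) summable_on_subset by blast
  have s: "(\<lambda>h. norm (J h * f k h)) summable_on A" for A k
  proof (rule Infinite_Sum.abs_summable_on_comparison_test')
    show "(\<lambda>h. C * J h) summable_on A"
      by (intro summable_on_cmult_right sJ)
    show "norm (J h * f k h) \<le> C * J h" for h
      using mult_left_mono[OF f[of k h] J(2)[of h]] J(2)[of h] by (simp add: abs_mult mult.commute)
  qed
  define e' where "e' = e / (2 * (C + 1))"
  have e': "0 < e'" "C * e' < e / 2"
    using e C by (auto simp: e'_def field_simps add_pos_nonneg)
  obtain F where F: "finite F" "\<bar>infsum J (- F)\<bar> \<le> e'"
    using infsum_tail_approx[OF J(1) e'(1)] by (metis subset_refl)
  have "(\<lambda>k. \<bar>\<Sum>h\<in>F. J h * f k h\<bar>) \<longlonglongrightarrow> \<bar>\<Sum>h\<in>F. J h * 0\<bar>"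
    by (intro tendsto_intros lim)
  then have "\<forall>\<^sub>F k in sequentially. \<bar>\<Sum>h\<in>F. J h * f k h\<bar> < e / 2"
    using e by (intro order_tendstoD(2)[of _ 0]) auto
  then show "\<forall>\<^sub>F k in sequentially. dist (\<Sum>\<^sub>\<infinity>h. J h * f k h) 0 < e"
  proof eventually_elim
    case (elim k)
    have "\<bar>\<Sum>\<^sub>\<infinity>h\<in>- F. J h * f k h\<bar> \<le> (\<Sum>\<^sub>\<infinity>h\<in>- F. \<bar>J h * f k h\<bar>)"
      using norm_infsum_bound[OF s, of k "- F"] by simp
    also have "\<dots> \<le> (\<Sum>\<^sub>\<infinity>h\<in>- F. C * J h)"
    proof (intro infsum_mono summable_on_cmult_right sJ)
      show "(\<lambda>h. \<bar>J h * f k h\<bar>) summable_on - F"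
        using s by simp
      show "\<bar>J h * f k h\<bar> \<le> C * J h" for h
        using mult_left_mono[OF f[of k h] J(2)[of h]] J(2)[of h] by (simp add: abs_mult mult.commute)
    qed
    also have "\<dots> = C * infsum J (- F)"
      by (rule infsum_cmult_right')
    also have "\<dots> \<le> C * e'"
      using F(2) C by (intro mult_left_mono) auto
    finally show ?case
      using elim e' infsum_split_finite[OF abs_summable_summable[OF s] F(1), of k]
      by (simp add: dist_real_def)
  qed
qed

section \<open>The Dirichlet form\<close>

lemma bij_add_right: "bij (\<lambda>n :: 'a::group_add. n + h)"
  by (rule bij_betw_byWitness[where f' = "\<lambda>n. n - h"]) (auto simp: algebra_simps)

lemma ell2_shift: "(\<lambda>n. u (n + h)) \<in> ell2 \<longleftrightarrow> u \<in> ell2" for h :: "'a::group_add"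
  unfolding ell2_def mem_Collect_eq by (rule summable_on_reindex_bij_betw[OF bij_add_right])

lemma mass_shift: "mass (\<lambda>n. u (n + h)) = mass u" for h :: "'a::group_add"
  unfolding mass_eq by (rule infsum_reindex_bij_betw[OF bij_add_right])

definition incr :: "('a::group_add \<Rightarrow> complex) \<Rightarrow> 'a \<Rightarrow> real" where
  "incr u h = mass (\<lambda>n. u n - u (n + h))"

text \<open>The factor 1/2 compensates for the jumps \<open>h\<close> and \<open>- h\<close>
  describing the same pairs of sites.\<close>

definition dirichlet :: "('a::group_add \<Rightarrow> real) \<Rightarrow> ('a \<Rightarrow> complex) \<Rightarrow> real" where
  "dirichlet J u = (\<Sum>\<^sub>\<infinity>h. J h * incr u h) / 2"

lemma incr_nonneg: "0 \<le> incr u h"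
  by (simp add: incr_def mass_nonneg)

lemma ell2_incr: "u \<in> ell2 \<Longrightarrow> (\<lambda>n. u n - u (n + h)) \<in> ell2" for h :: "'a::group_add"
  by (rule ell2_diff(1)) (simp_all add: ell2_shift)

lemma incr_le: "u \<in> ell2 \<Longrightarrow> incr u h \<le> 4 * mass u"
  using ell2_diff(2)[of u "\<lambda>n. u (n + h)"] by (simp add: incr_def ell2_shift mass_shift)

lemma incr_cmult: "incr (\<lambda>n. c * u n) h = (cmod c)\<^sup>2 * incr u h"
  unfolding incr_def by (subst mass_cmult[symmetric]) (simp add: right_diff_distrib)

lemma incr_shift: "incr (\<lambda>n. u (n + a)) h = incr u h" for a :: "'a::ab_group_add"
  unfolding incr_def
  by (subst mass_shift[of "\<lambda>n. u n - u (n + h)" a, symmetric]) (simp add: add_ac)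

lemma dirichlet_cmult: "dirichlet J (\<lambda>n. c * u n) = (cmod c)\<^sup>2 * dirichlet J u"
  unfolding dirichlet_def incr_cmult mult.left_commute[of "J _"] infsum_cmult_right' by simp

lemma dirichlet_shift: "dirichlet J (\<lambda>n. u (n + a)) = dirichlet J u" for a :: "'a::ab_group_add"
  by (simp add: dirichlet_def incr_shift)

locale symmetric_kernel =
  fixes J :: "'a::ab_group_add \<Rightarrow> real"
  assumes J_nonneg: "\<And>h. 0 \<le> J h"
    and J_sym: "\<And>h. J (- h) = J h"
    and J_summable: "J summable_on UNIV"
begin

lemma summable_incr: "u \<in> ell2 \<Longrightarrow> (\<lambda>h. J h * incr u h) summable_on A"
proof -
  assume u: "u \<in> ell2"
  have "(\<lambda>h. J h * incr u h) summable_on UNIV"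
  proof (rule summable_on_comparison_test)
    show "(\<lambda>h. J h * (4 * mass u)) summable_on UNIV"
      by (intro summable_on_cmult_left J_summable)
  qed (auto intro!: mult_left_mono incr_le u J_nonneg mult_nonneg_nonneg incr_nonneg)
  then show ?thesis
    using summable_on_subset by blast
qed

lemma dirichlet_nonneg: "0 \<le> dirichlet J u"
  by (simp add: dirichlet_def infsum_nonneg J_nonneg incr_nonneg)

lemma sum_incr_le_dirichlet:
  "u \<in> ell2 \<Longrightarrow> finite A \<Longrightarrow> (\<Sum>h\<in>A. J h * incr u h) \<le> 2 * dirichlet J u"
  unfolding dirichlet_def
  by (auto intro!: finite_sum_le_infsum summable_incr mult_nonneg_nonneg J_nonneg incr_nonneg)

text \<open>For each jump \<open>h\<close> the cross term is a weak pairing of the increments of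
  \<open>q\<close> with those of \<open>r k\<close>, hence tends to 0; it is bounded uniformly in
  \<open>h\<close>, so the sum against \<open>J\<close> tends to 0 as well.\<close>

lemma dirichlet_splitting:
  assumes q: "q \<in> ell2" and r: "\<And>k. r k \<in> ell2" "\<And>k. mass (r k) \<le> C"
    and lim: "\<And>n. (\<lambda>k. r k n) \<longlonglongrightarrow> 0"
  shows "(\<lambda>k. dirichlet J (\<lambda>n. q n + r k n) - dirichlet J (r k)) \<longlonglongrightarrow> dirichlet J q"
proof -
  define X where "X k h = incr (\<lambda>n. q n + r k n) h - incr q h - incr (r k) h" for k h
  have sum: "(\<lambda>n. q n + r k n) \<in> ell2" for k
    using ell2_diff(1)[OF q ell2_cmult[OF r(1), of "- 1"]] by simp
  have cross: "\<bar>(cmod (a + b))\<^sup>2 - (cmod a)\<^sup>2 - (cmod b)\<^sup>2\<bar> \<le> 2 * (cmod a * cmod b)" for a b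
  proof -
    have "(cmod (a + b))\<^sup>2 - (cmod a)\<^sup>2 - (cmod b)\<^sup>2 = 2 * Re (a * cnj b)"
      by (simp only: cmod_power2) (simp add: power2_eq_square algebra_simps)
    also have "\<bar>\<dots>\<bar> \<le> 2 * cmod (a * cnj b)"
      using abs_Re_le_cmod[of "a * cnj b"] by linarith
    finally show ?thesis
      by (simp add: norm_mult)
  qed
  have mass_cross: "\<bar>mass (\<lambda>n. a n + b n) - mass a - mass b\<bar> \<le> 2 * (\<Sum>\<^sub>\<infinity>n. cmod (a n) * cmod (b n))"
    if ab: "a \<in> ell2" "b \<in> ell2" "(\<lambda>n. a n + b n) \<in> ell2" for a b :: "'a \<Rightarrow> complex"
  proof -
    define f where "f n = (cmod (a n + b n))\<^sup>2 - (cmod (a n))\<^sup>2 - (cmod (b n))\<^sup>2" for n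
    have bound: "norm (f n) \<le> 2 * (cmod (a n) * cmod (b n))" for n
      using cross by (simp add: f_def)
    have s: "(\<lambda>n. 2 * (cmod (a n) * cmod (b n))) summable_on UNIV"
      by (intro summable_on_cmult_right ell2_mult_summable ab)
    have fs: "(\<lambda>n. norm (f n)) summable_on UNIV"
      by (rule Infinite_Sum.abs_summable_on_comparison_test'[OF s bound])
    have "mass (\<lambda>n. a n + b n) = (\<Sum>\<^sub>\<infinity>n. f n + ((cmod (a n))\<^sup>2 + (cmod (b n))\<^sup>2))"
      by (simp add: mass_eq f_def)
    also have "\<dots> = infsum f UNIV + (mass a + mass b)"
      unfolding mass_eq
      by (simp only: infsum_add summable_on_add abs_summable_summable[OF fs] ell2_summable ab)
    finally have "mass (\<lambda>n. a n + b n) - mass a - mass b = infsum f UNIV"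
      by simp
    also have "\<bar>\<dots>\<bar> \<le> (\<Sum>\<^sub>\<infinity>n. norm (f n))"
      using norm_infsum_bound[OF fs] by simp
    also have "\<dots> \<le> (\<Sum>\<^sub>\<infinity>n. 2 * (cmod (a n) * cmod (b n)))"
      by (intro infsum_mono fs s bound)
    finally show ?thesis
      by (simp only: infsum_cmult_right')
  qed
  have X_bound: "\<bar>X k h\<bar> \<le> 2 * (\<Sum>\<^sub>\<infinity>n. cmod (q n - q (n + h)) * cmod (r k n - r k (n + h)))" for k h
    using mass_cross[OF ell2_incr[OF q] ell2_incr[OF r(1)], of h k h] ell2_incr[OF sum, of k h]
    by (simp add: X_def incr_def algebra_simps)
  have X_lim: "(\<lambda>k. X k h) \<longlonglongrightarrow> 0" for h
  proof (rule Lim_null_comparison)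
    have "(\<lambda>k. \<Sum>\<^sub>\<infinity>n. cmod (q n - q (n + h)) * cmod (r k n - r k (n + h))) \<longlonglongrightarrow> 0"
    proof (rule weak_pairing_tendsto_0[OF ell2_incr[OF q] ell2_incr[OF r(1)], where C = "4 * C"])
      show "mass (\<lambda>n. r k n - r k (n + h)) \<le> 4 * C" for k
        using incr_le[OF r(1), of k h] r(2)[of k] by (simp add: incr_def)
      show "(\<lambda>k. r k n - r k (n + h)) \<longlonglongrightarrow> 0" for n
        using tendsto_diff[OF lim lim] by simp
    qed
    then show "(\<lambda>k. 2 * (\<Sum>\<^sub>\<infinity>n. cmod (q n - q (n + h)) * cmod (r k n - r k (n + h)))) \<longlonglongrightarrow> 0"
      using tendsto_mult_right_zero by blast
  qed (use X_bound in auto)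
  have "\<bar>X k h\<bar> \<le> 2 * (4 * mass q + 4 * C)" for k h
  proof -
    note infsum_mult_le_mass[OF ell2_incr[OF q] ell2_incr[OF r(1)], of h k h]
    also have "mass (\<lambda>n. q n - q (n + h)) + mass (\<lambda>n. r k n - r k (n + h)) \<le> 4 * mass q + 4 * C"
      using incr_le[OF q, of h] incr_le[OF r(1), of k h] r(2)[of k] by (simp add: incr_def)
    finally show ?thesis
      using X_bound[of k h] by simp
  qed
  then have "(\<lambda>k. \<Sum>\<^sub>\<infinity>h. J h * X k h) \<longlonglongrightarrow> 0"
    by (rule tannery[OF J_summable J_nonneg _ X_lim])
  moreover have "dirichlet J (\<lambda>n. q n + r k n) - dirichlet J (r k)
      = dirichlet J q + (\<Sum>\<^sub>\<infinity>h. J h * X k h) / 2" for k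
  proof -
    have "(\<lambda>h. J h * incr (\<lambda>n. q n + r k n) h)
        = (\<lambda>h. J h * X k h + (J h * incr q h + J h * incr (r k) h))"
      by (simp add: X_def algebra_simps)
    moreover have "(\<lambda>h. J h * X k h)
        = (\<lambda>h. J h * incr (\<lambda>n. q n + r k n) h + ((- 1) * (J h * incr q h) + (- 1) * (J h * incr (r k) h)))"
      by (simp add: X_def algebra_simps)
    then have "(\<lambda>h. J h * X k h) summable_on UNIV"
      by (simp only: summable_on_add summable_incr summable_on_cmult_right sum q r)
    ultimately show ?thesis
      unfolding dirichlet_def
      by (simp add: infsum_add summable_on_add summable_incr q r add_divide_distrib)
  qed
  ultimately show ?thesis
    using tendsto_add[OF tendsto_const tendsto_divide[OF _ tendsto_const], of _ 0 sequentially 2]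
    by fastforce
qed

end

text \<open>After an exchange of sums, each jump \<open>h\<close> contributes the real part of the
  pairing of \<open>u - u(\<cdot> + h)\<close> with \<open>u\<close>, which is half of
  \<open>incr u h\<close> because a shift preserves the mass.\<close>

lemma lattice_form_eq:
  fixes J :: "int ^ 'd::finite \<Rightarrow> real"
  assumes "symmetric_kernel J" "J 0 = 0" and u: "u \<in> ell2"
  shows "lattice_form J u = dirichlet J u"
proof -
  interpret symmetric_kernel J by fact
  have op: "lattice_op J u n = (\<Sum>\<^sub>\<infinity>h. of_real (J h) * (u n - u (n + h)))" for n
  proof -
    have "lattice_op J u n = (\<Sum>\<^sub>\<infinity>m. of_real (J (n - m)) * (u n - u m))"
      unfolding lattice_op_def by (rule infsum_cong_neutral) (auto simp: assms(2))
    also have "\<dots> = (\<Sum>\<^sub>\<infinity>h. of_real (J (n - (h + n))) * (u n - u (h + n)))"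
      by (rule infsum_reindex_bij_betw[OF bij_add_right, symmetric])
    finally show ?thesis
      by (simp add: J_sym add.commute)
  qed
  define F where "F n h = of_real (J h) * (u n - u (n + h)) * cnj (u n)" for n h
  \<comment> \<open>The majorant is summed over \<open>n\<close> first: shift invariance makes the
    inner sum \<open>3 * mass u\<close>, independent of \<open>h\<close>, and summability of
    \<open>J\<close> does the rest.\<close>
  have "(\<lambda>(h, n). J h * (2 * (cmod (u n))\<^sup>2 + (cmod (u (n + h)))\<^sup>2)) summable_on UNIV \<times> UNIV"
  proof (rule summable_on_SigmaI)
    fix h
    have "((\<lambda>n. (cmod (u (n + h)))\<^sup>2) has_sum mass u) UNIV"
      by (subst mass_shift[of u h, symmetric], unfold mass_eq)
        (rule has_sum_infsum, rule ell2_summable, simp add: ell2_shift u)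
    moreover have "((\<lambda>n. (cmod (u n))\<^sup>2) has_sum mass u) UNIV"
      unfolding mass_eq by (rule has_sum_infsum, rule ell2_summable, fact)
    ultimately show "((\<lambda>n. case (h, n) of (h, n) \<Rightarrow> J h * (2 * (cmod (u n))\<^sup>2 + (cmod (u (n + h)))\<^sup>2))
        has_sum J h * (2 * mass u + mass u)) UNIV"
      unfolding prod.case by (intro has_sum_cmult_right has_sum_add)
  qed (auto intro!: summable_on_cmult_left J_summable simp: J_nonneg)
  then have "(\<lambda>(n, h). J h * (2 * (cmod (u n))\<^sup>2 + (cmod (u (n + h)))\<^sup>2)) summable_on UNIV \<times> UNIV"
    by (subst (asm) summable_on_swap) (simp add: case_prod_unfold comp_def)
  then have "(\<lambda>x. norm ((\<lambda>(n, h). F n h) x)) summable_on UNIV \<times> UNIV"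
  proof (rule Infinite_Sum.abs_summable_on_comparison_test')
    fix x :: "(int ^ 'd) \<times> (int ^ 'd)"
    obtain n h where x: "x = (n, h)" by force
    have "cmod (u n - u (n + h)) * cmod (u n) \<le> (cmod (u n) + cmod (u (n + h))) * cmod (u n)"
      by (intro mult_right_mono norm_triangle_ineq4) auto
    also have "\<dots> \<le> 2 * (cmod (u n))\<^sup>2 + (cmod (u (n + h)))\<^sup>2"
      using mult_le_sum_power2[of "cmod (u n)" "cmod (u (n + h))"]
      by (simp add: power2_eq_square algebra_simps)
    finally show "norm ((\<lambda>(n, h). F n h) x)
        \<le> (\<lambda>(n, h). J h * (2 * (cmod (u n))\<^sup>2 + (cmod (u (n + h)))\<^sup>2)) x"
      using mult_left_mono[OF _ J_nonneg[of h]]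
      by (simp add: x F_def norm_mult J_nonneg mult.assoc)
  qed
  then have F: "(\<lambda>(n, h). F n h) summable_on UNIV \<times> UNIV"
    by (rule abs_summable_summable)
  then have F': "(\<lambda>(h, n). F n h) summable_on UNIV \<times> UNIV"
    by (subst (asm) summable_on_swap) (simp add: case_prod_unfold comp_def)
  define c where "c h = (\<Sum>\<^sub>\<infinity>n. (u n - u (n + h)) * cnj (u n))" for h
  have inner: "(\<Sum>\<^sub>\<infinity>n. F n h) = of_real (J h) * c h" for h
    by (simp add: F_def c_def infsum_cmult_right' mult.assoc)
  have Re_c: "Re (c h) = incr u h / 2" for h
  proof -
    have "(\<lambda>n. cmod (u n - u (n + h)) * cmod (u n)) summable_on UNIV"
      by (intro ell2_mult_summable ell2_incr u)
    then have s: "(\<lambda>n. (u n - u (n + h)) * cnj (u n)) summable_on UNIV"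
      unfolding summable_on_iff_abs_summable_on_complex by (simp add: norm_mult)
    \<comment> \<open>With \<open>a = u n\<close> and \<open>b = u (n + h)\<close> the last two
      terms cancel after summation over \<open>n\<close>.\<close>
    have pt: "(cmod (a - b))\<^sup>2 = 2 * Re ((a - b) * cnj a) + ((- 1) * (cmod a)\<^sup>2 + (cmod b)\<^sup>2)" for a b
      by (simp only: cmod_power2) (simp add: power2_eq_square algebra_simps)
    have sh: "(\<lambda>n. (cmod (u (n + h)))\<^sup>2) summable_on UNIV"
      by (rule ell2_summable) (simp add: ell2_shift u)
    have "incr u h = (\<Sum>\<^sub>\<infinity>n. 2 * Re ((u n - u (n + h)) * cnj (u n))
        + ((- 1) * (cmod (u n))\<^sup>2 + (cmod (u (n + h)))\<^sup>2))"
      unfolding incr_def mass_eq by (intro infsum_cong) (rule pt)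
    also have "\<dots> = 2 * Re (c h) + ((- 1) * mass u + mass (\<lambda>n. u (n + h)))"
      unfolding mass_eq c_def
      by (intro infsumI has_sum_add has_sum_cmult_right has_sum_Re has_sum_infsum s sh
          ell2_summable[OF u])
    finally show ?thesis
      by (simp add: mass_shift)
  qed
  have "ell2_inner (lattice_op J u) u = (\<Sum>\<^sub>\<infinity>n. \<Sum>\<^sub>\<infinity>h. F n h)"
    unfolding ell2_inner_def op F_def by (simp add: infsum_cmult_left')
  also have "\<dots> = (\<Sum>\<^sub>\<infinity>h. \<Sum>\<^sub>\<infinity>n. F n h)"
    by (rule infsum_swap_banach[OF F])
  also have "\<dots> = (\<Sum>\<^sub>\<infinity>h. of_real (J h) * c h)"
    by (simp add: inner)
  finally have "lattice_form J u = Re (\<Sum>\<^sub>\<infinity>h. of_real (J h) * c h)"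
    by (simp add: lattice_form_def)
  also have "\<dots> = (\<Sum>\<^sub>\<infinity>h. Re (of_real (J h) * c h))"
    using summable_on_Sigma_banach[OF F'] by (intro infsum_Re[symmetric]) (simp add: inner)
  also have "\<dots> = (\<Sum>\<^sub>\<infinity>h. J h * incr u h / 2)"
    by (simp add: Re_c)
  also have "\<dots> = dirichlet J u"
    unfolding dirichlet_def divide_inverse infsum_cmult_left' ..
  finally show ?thesis .
qed

section \<open>Power sums\<close>

definition power_sum :: "real \<Rightarrow> ('a \<Rightarrow> complex) \<Rightarrow> real" where
  "power_sum s u = (\<Sum>\<^sub>\<infinity>n. cmod (u n) powr s)"

lemma power_sum_nonneg: "0 \<le> power_sum s u"
  unfolding power_sum_def by (intro infsum_nonneg) auto

lemma lp_norm_powr: "s \<noteq> 0 \<Longrightarrow> lp_norm s u powr s = power_sum s u"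
  using power_sum_nonneg[of s u] by (simp add: lp_norm_def powr_powr power_sum_def)

lemma lp_norm_2_powr: "lp_norm 2 u powr s = mass u powr (s / 2)"
proof -
  have "0 \<le> lp_norm 2 u"
    by (simp add: lp_norm_def)
  then have "lp_norm 2 u = mass u powr (1 / 2)"
    by (simp add: mass_def powr_half_sqrt)
  then show ?thesis
    by (simp add: powr_powr)
qed

lemma power_sum_cmult: "power_sum s (\<lambda>n. c * u n) = cmod c powr s * power_sum s u"
  by (simp add: power_sum_def norm_mult powr_mult infsum_cmult_right')

lemma power_sum_shift: "power_sum s (\<lambda>n. u (n + h)) = power_sum s u" for h :: "'a::group_add"
  unfolding power_sum_def by (rule infsum_reindex_bij_betw[OF bij_add_right])

lemma powr_le_mult_power2:
  fixes x a s :: real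
  assumes "0 \<le> x" "x \<le> a" "2 \<le> s"
  shows "x powr s \<le> a powr (s - 2) * x\<^sup>2"
proof (cases "x = 0")
  case False
  have "x powr s = x powr (s - 2) * x powr 2"
    by (simp flip: powr_add)
  also have "\<dots> \<le> a powr (s - 2) * x powr 2"
    using assms by (intro mult_right_mono powr_mono2) auto
  finally show ?thesis
    using assms(1) by simp
qed auto

lemma cmod_le_sqrt_mass: "u \<in> ell2 \<Longrightarrow> cmod (u n) \<le> sqrt (mass u)"
  using norm_sq_le_mass by (intro real_le_rsqrt)

lemma powr_summable:
  assumes u: "u \<in> ell2" and s: "2 \<le> s"
  shows "(\<lambda>n. cmod (u n) powr s) summable_on A"
proof -
  have "(\<lambda>n. cmod (u n) powr s) summable_on UNIV"
    using summable_on_cmult_right[OF ell2_summable[OF u]]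
    by (rule summable_on_comparison_test)
      (use powr_le_mult_power2[OF _ cmod_le_sqrt_mass[OF u] s] in auto)
  then show ?thesis
    using summable_on_subset by blast
qed

text \<open>A uniformly small function of bounded mass has a small power sum when
  \<open>s > 2\<close>. This is what excludes vanishing of minimizing sequences.\<close>

lemma power_sum_le:
  assumes u: "u \<in> ell2" and s: "2 \<le> s" and a: "\<And>n. cmod (u n) \<le> a"
  shows "power_sum s u \<le> a powr (s - 2) * mass u"
proof -
  have "power_sum s u \<le> (\<Sum>\<^sub>\<infinity>n. a powr (s - 2) * (cmod (u n))\<^sup>2)"
    unfolding power_sum_def
    by (intro infsum_mono powr_summable u s summable_on_cmult_right ell2_summable
        powr_le_mult_power2 a) auto
  then show ?thesis
    by (simp add: mass_eq infsum_cmult_right')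
qed

lemma power_sum_le_mass:
  assumes "u \<in> ell2" "2 \<le> s"
  shows "power_sum s u \<le> mass u powr (s / 2)"
proof -
  have "power_sum s u \<le> sqrt (mass u) powr (s - 2) * mass u"
    by (rule power_sum_le[OF assms cmod_le_sqrt_mass[OF assms(1)]])
  also have "\<dots> = mass u powr ((s - 2) / 2) * mass u powr 1"
    using mass_nonneg[of u] by (simp add: powr_half_sqrt[symmetric] powr_powr)
  also have "\<dots> = mass u powr (s / 2)"
    unfolding powr_add[symmetric] by (simp add: diff_divide_distrib)
  finally show ?thesis .
qed

lemma power_sum_pos:
  assumes "u \<in> ell2" "2 \<le> s" "u n \<noteq> 0"
  shows "0 < power_sum s u"
proof -
  have "0 < (\<Sum>m\<in>{n}. cmod (u m) powr s)"
    using assms(3) by simp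
  also have "\<dots> \<le> power_sum s u"
    unfolding power_sum_def by (rule finite_sum_le_infsum[OF powr_summable[OF assms(1,2)]]) auto
  finally show ?thesis .
qed

lemma powr_diff_le:
  fixes x y s :: real
  assumes "0 \<le> x" "x \<le> y" "1 \<le> s"
  shows "y powr s - x powr s \<le> s * (y - x) * y powr (s - 1)"
proof (cases "x = 0 \<or> x = y")
  case True
  then show ?thesis
  proof
    assume x: "x = 0"
    show ?thesis
    proof (cases "y = 0")
      case False
      then have "y powr s = y * y powr (s - 1)"
        using assms by (simp add: powr_mult_base)
      moreover have "1 * (y * y powr (s - 1)) \<le> s * (y * y powr (s - 1))"
        using assms by (intro mult_right_mono) auto
      ultimately show ?thesis
        using x by (simp add: mult.assoc)
    qed (use x in auto)
  qed auto
next
  case False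
  then have xy: "0 < x" "x < y"
    using assms by auto
  have "\<exists>z>x. z < y \<and> y powr s - x powr s = (y - x) * (s * z powr (s - 1))"
    using xy by (intro MVT2) (auto intro!: derivative_eq_intros)
  then obtain z where z: "x < z" "z < y" "y powr s - x powr s = (y - x) * (s * z powr (s - 1))"
    by blast
  have "z powr (s - 1) \<le> y powr (s - 1)"
    using z xy assms by (intro powr_mono2) auto
  then have "(y - x) * (s * z powr (s - 1)) \<le> (y - x) * (s * y powr (s - 1))"
    using xy assms by (intro mult_left_mono) auto
  then show ?thesis
    using z(3) by (simp add: mult_ac)
qed

lemma abs_powr_diff_le:
  fixes x y s M :: real
  assumes "0 \<le> x" "0 \<le> y" "x \<le> M" "y \<le> M" "1 \<le> s"
  shows "\<bar>y powr s - x powr s\<bar> \<le> s * \<bar>y - x\<bar> * M powr (s - 1)"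
proof -
  have *: "\<bar>y powr s - x powr s\<bar> \<le> s * \<bar>y - x\<bar> * M powr (s - 1)"
    if "0 \<le> x" "x \<le> y" "y \<le> M" for x y
  proof -
    have "y powr s - x powr s \<le> s * (y - x) * y powr (s - 1)"
      using that assms by (intro powr_diff_le) auto
    also have "\<dots> \<le> s * (y - x) * M powr (s - 1)"
      using that assms by (intro mult_left_mono powr_mono2) auto
    finally show ?thesis
      using that powr_mono2[of s x y] assms by simp
  qed
  show ?thesis
    using *[of x y] *[of y x] assms by (cases "x \<le> y") (auto simp: abs_minus_commute)
qed

text \<open>A bound that is bilinear in the norms suits the weak pairing directly. It is available
  because \<open>s \<ge> 2\<close> and because on a lattice the mass controls the supremum, so that
  a common \<open>K\<close> exists. By symmetry \<open>a\<close> may be taken as the smaller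
  vector.\<close>

lemma brezis_lieb_pointwise:
  fixes a b :: "'a::real_normed_vector"
  assumes K: "norm a \<le> K" "norm b \<le> K" and s: "2 \<le> s"
  shows "\<bar>norm (a + b) powr s - norm a powr s - norm b powr s\<bar>
    \<le> (s * 2 powr (s - 1) + 1) * K powr (s - 2) * (norm a * norm b)"
proof -
  have *: "\<bar>norm (a + b) powr s - norm a powr s - norm b powr s\<bar>
      \<le> (s * 2 powr (s - 1) + 1) * K powr (s - 2) * (norm a * norm b)"
    if ab: "norm a \<le> norm b" "norm b \<le> K" for a b :: 'a
  proof (cases "b = 0")
    case False
    let ?x = "norm a" and ?y = "norm b"
    have y: "?y powr (s - 1) \<le> ?y * K powr (s - 2)"
    proof -
      have "?y powr (s - 1) = ?y * ?y powr (s - 2)"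
        using False by (simp add: powr_mult_base)
      also have "\<dots> \<le> ?y * K powr (s - 2)"
        using ab s by (intro mult_left_mono powr_mono2) auto
      finally show ?thesis .
    qed
    \<comment> \<open>Since \<open>a\<close> is the smaller vector, both \<open>norm (a + b)\<close>
      and \<open>norm b\<close> lie below \<open>2 * norm b\<close>; this is the source of the
      factor \<open>2 powr (s - 1)\<close>.\<close>
    have "\<bar>norm (a + b) powr s - ?y powr s\<bar> \<le> s * \<bar>norm (a + b) - ?y\<bar> * (2 * ?y) powr (s - 1)"
      using ab s norm_triangle_ineq[of a b] by (intro abs_powr_diff_le) auto
    also have "\<dots> \<le> s * ?x * (2 * ?y) powr (s - 1)"
      using s norm_triangle_ineq3[of "a + b" b] by (intro mult_right_mono mult_left_mono) auto
    also have "\<dots> = s * ?x * 2 powr (s - 1) * ?y powr (s - 1)"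
      by (simp add: powr_mult)
    also have "\<dots> \<le> s * ?x * 2 powr (s - 1) * (?y * K powr (s - 2))"
      using s by (intro mult_left_mono y) auto
    finally have 1: "\<bar>norm (a + b) powr s - ?y powr s\<bar> \<le> s * 2 powr (s - 1) * K powr (s - 2) * (?x * ?y)"
      by (simp add: mult_ac)
    have "?x powr s \<le> K powr (s - 2) * (?x * ?y)"
    proof (cases "a = 0")
      case False
      then have "?x powr s = ?x * ?x powr (s - 1)"
        by (simp add: powr_mult_base)
      also have "\<dots> \<le> ?x * ?y powr (s - 1)"
        using ab s by (intro mult_left_mono powr_mono2) auto
      also have "\<dots> \<le> ?x * (?y * K powr (s - 2))"
        by (intro mult_left_mono y) auto
      finally show ?thesis
        by (simp add: mult_ac)
    qed auto
    with 1 show ?thesis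
      unfolding distrib_right mult_1 by (smt (verit) powr_ge_zero)
  qed (use that in auto)
  show ?thesis
    using *[of a b] *[of b a] K by (cases "norm a \<le> norm b") (auto simp: add.commute mult.commute algebra_simps)
qed

lemma brezis_lieb:
  assumes q: "q \<in> ell2" and r: "\<And>k. r k \<in> ell2" "\<And>k. mass (r k) \<le> C"
    and lim: "\<And>n. (\<lambda>k. r k n) \<longlonglongrightarrow> 0" and s: "2 \<le> s"
  shows "(\<lambda>k. power_sum s (\<lambda>n. q n + r k n) - power_sum s (r k)) \<longlonglongrightarrow> power_sum s q"
proof -
  define K where "K = max (sqrt (mass q)) (sqrt C)"
  define D where "D = (s * 2 powr (s - 1) + 1) * K powr (s - 2)"
  have K: "cmod (q n) \<le> K" "cmod (r k n) \<le> K" for n k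
    using cmod_le_sqrt_mass[OF q, of n] cmod_le_sqrt_mass[OF r(1), of k n]
      real_sqrt_le_mono[OF r(2)[of k]] unfolding K_def by linarith+
  have sum: "(\<lambda>n. q n + r k n) \<in> ell2" for k
    using ell2_diff(1)[OF q ell2_cmult[OF r(1), of "- 1"]] by simp
  define f where "f k n = cmod (q n + r k n) powr s - cmod (q n) powr s - cmod (r k n) powr s" for k n
  have f: "norm (f k n) \<le> D * (cmod (q n) * cmod (r k n))" for k n
    using brezis_lieb_pointwise[OF K s, of n k n] by (simp add: f_def D_def)
  have sD: "(\<lambda>n. D * (cmod (q n) * cmod (r k n))) summable_on UNIV" for k
    by (intro summable_on_cmult_right ell2_mult_summable q r)
  have sf: "(\<lambda>n. norm (f k n)) summable_on UNIV" for k
    by (rule Infinite_Sum.abs_summable_on_comparison_test'[OF sD f])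
  have "(\<lambda>k. infsum (f k) UNIV) \<longlonglongrightarrow> 0"
  proof (rule Lim_null_comparison)
    show "(\<lambda>k. D * (\<Sum>\<^sub>\<infinity>n. cmod (q n) * cmod (r k n))) \<longlonglongrightarrow> 0"
      by (intro tendsto_mult_right_zero weak_pairing_tendsto_0[OF q r lim])
    have "norm (infsum (f k) UNIV) \<le> D * (\<Sum>\<^sub>\<infinity>n. cmod (q n) * cmod (r k n))" for k
      using order_trans[OF norm_infsum_bound[OF sf] infsum_mono[OF sf sD f]]
      by (simp only: infsum_cmult_right')
    then show "\<forall>\<^sub>F k in sequentially. norm (infsum (f k) UNIV)
        \<le> D * (\<Sum>\<^sub>\<infinity>n. cmod (q n) * cmod (r k n))"
      by simp
  qed
  moreover have "power_sum s (\<lambda>n. q n + r k n) - power_sum s (r k) = power_sum s q + infsum (f k) UNIV" for k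
  proof -
    have "power_sum s (\<lambda>n. q n + r k n)
        = (\<Sum>\<^sub>\<infinity>n. f k n + (cmod (q n) powr s + cmod (r k n) powr s))"
      by (simp add: power_sum_def f_def)
    also have "\<dots> = infsum (f k) UNIV + (power_sum s q + power_sum s (r k))"
      unfolding power_sum_def
      by (intro infsumI has_sum_add has_sum_infsum abs_summable_summable[OF sf] powr_summable q r s)
    finally show ?thesis
      by simp
  qed
  ultimately show ?thesis
    using tendsto_add[OF tendsto_const, of "\<lambda>k. infsum (f k) UNIV" 0 sequentially "power_sum s q"]
    by simp
qed

section \<open>Ground states\<close>

lemma mass_splitting:
  assumes q: "q \<in> ell2" and r: "\<And>k. r k \<in> ell2" "\<And>k. mass (r k) \<le> C"
    and lim: "\<And>n. (\<lambda>k. r k n) \<longlonglongrightarrow> 0"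
  shows "(\<lambda>k. mass (\<lambda>n. q n + r k n) - mass (r k)) \<longlonglongrightarrow> mass q"
  using brezis_lieb[OF q r lim, of 2] by (simp add: power_sum_def mass_eq)

text \<open>Fatou's lemma, read off from finite partial sums.\<close>

lemma ell2_pointwise_limit:
  assumes u: "\<And>k. u k \<in> ell2" "\<And>k. mass (u k) \<le> C" and lim: "\<And>n. (\<lambda>k. u k n) \<longlonglongrightarrow> q n"
  shows "q \<in> ell2" "mass q \<le> C"
proof -
  have fin: "(\<Sum>n\<in>F. (cmod (q n))\<^sup>2) \<le> C" if "finite F" for F
  proof (rule tendsto_upperbound)
    show "(\<lambda>k. \<Sum>n\<in>F. (cmod (u k n))\<^sup>2) \<longlonglongrightarrow> (\<Sum>n\<in>F. (cmod (q n))\<^sup>2)"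
      by (intro tendsto_intros lim)
    show "\<forall>\<^sub>F k in sequentially. (\<Sum>n\<in>F. (cmod (u k n))\<^sup>2) \<le> C"
      using order_trans[OF sum_norm_sq_le_mass[OF u(1) that] u(2)] by simp
  qed auto
  show q: "q \<in> ell2"
    unfolding ell2_def mem_Collect_eq
    by (rule nonneg_bdd_above_summable_on) (auto intro!: bdd_aboveI2[of _ _ C] fin)
  show "mass q \<le> C"
    unfolding mass_eq by (rule infsum_le_finite_sums) (auto intro: fin ell2_summable[OF q])
qed

locale lattice_kernel = symmetric_kernel J for J :: "int ^ 'd::finite \<Rightarrow> real" +
  fixes p :: real
  assumes p: "1 < p" and J_0: "J 0 = 0"
begin

lemma energy_eq:
  "u \<in> ell2 \<Longrightarrow> energy J p u = dirichlet J u / 2 - power_sum (p + 1) u / (p + 1)"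
  using p by (simp add: energy_def lattice_form_eq symmetric_kernel_axioms J_0 lp_norm_powr)

lemma energy_cmult:
  assumes "u \<in> ell2"
  shows "energy J p (\<lambda>n. c * u n)
    = (cmod c)\<^sup>2 * dirichlet J u / 2 - cmod c powr (p + 1) * power_sum (p + 1) u / (p + 1)"
  using assms by (simp add: energy_eq ell2_cmult dirichlet_cmult power_sum_cmult)

lemma energy_lower_bound:
  assumes "u \<in> ell2"
  shows "- (mass u powr ((p + 1) / 2) / (p + 1)) \<le> energy J p u"
proof -
  have "power_sum (p + 1) u / (p + 1) \<le> mass u powr ((p + 1) / 2) / (p + 1)"
    using p by (intro divide_right_mono power_sum_le_mass assms) auto
  then show ?thesis
    using dirichlet_nonneg[of u] by (simp add: energy_eq assms)
qed

lemma energy_bdd_below: "bdd_below {energy J p q | q. q \<in> ell2 \<and> mass q = \<nu>}"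
  by (rule bdd_belowI[of _ "- (\<nu> powr ((p + 1) / 2) / (p + 1))"]) (use energy_lower_bound in auto)

lemma ground_energy_le: "u \<in> ell2 \<Longrightarrow> mass u = \<nu> \<Longrightarrow> ground_energy J p \<nu> \<le> energy J p u"
  unfolding ground_energy_def by (rule cInf_lower[OF _ energy_bdd_below]) auto

lemma ground_energy_set_nonempty:
  assumes "0 \<le> \<nu>"
  shows "{energy J p q | q. q \<in> ell2 \<and> mass q = \<nu>} \<noteq> {}"
proof -
  define u :: "int ^ 'd \<Rightarrow> complex" where "u n = (if n = 0 then of_real (sqrt \<nu>) else 0)" for n
  have "u \<in> ell2"
    by (rule ell2_if_finite_support) (auto simp: u_def intro: finite_subset[of _ "{0}"])
  moreover have "mass u = (\<Sum>\<^sub>\<infinity>n\<in>{0}. (cmod (u n))\<^sup>2)"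
    unfolding mass_eq by (rule infsum_cong_neutral) (auto simp: u_def)
  then have "mass u = \<nu>"
    using assms by (simp add: u_def)
  ultimately show ?thesis
    by blast
qed

text \<open>The competitor is \<open>u\<close> times the square root of
  \<open>\<nu> / mass u\<close>. Its quadratic part scales linearly in the mass and its nonlinear
  part with the power (p + 1) / 2 > 1; the subtracted term is this discrepancy.\<close>

lemma energy_scaling:
  assumes u: "u \<in> ell2" "0 < mass u" and \<nu>: "0 \<le> \<nu>"
  shows "ground_energy J p \<nu> \<le> (\<nu> / mass u) * energy J p u
    - ((\<nu> / mass u) powr ((p + 1) / 2) - \<nu> / mass u) * power_sum (p + 1) u / (p + 1)"
proof -
  define t where "t = \<nu> / mass u"
  have t: "0 \<le> t"
    using \<nu> u by (simp add: t_def)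
  have "mass (\<lambda>n. of_real (sqrt t) * u n) = \<nu>"
    using u t by (simp add: mass_cmult) (simp add: t_def)
  then have "ground_energy J p \<nu> \<le> energy J p (\<lambda>n. of_real (sqrt t) * u n)"
    by (rule ground_energy_le[OF ell2_cmult[OF u(1)]])
  also have "\<dots> = t * dirichlet J u / 2 - t powr ((p + 1) / 2) * power_sum (p + 1) u / (p + 1)"
    using t by (simp add: energy_cmult u(1)) (simp add: powr_half_sqrt[symmetric] powr_powr)
  also have "\<dots> = t * energy J p u - (t powr ((p + 1) / 2) - t) * power_sum (p + 1) u / (p + 1)"
    by (simp add: energy_eq u(1) left_diff_distrib right_diff_distrib diff_divide_distrib)
  finally show ?thesis
    by (simp add: t_def)
qed

text \<open>These bounds take the place of the strict subadditivity of the ground energy: a function of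
  mass below \<open>\<nu>\<close> has more energy per unit of mass than the infimum at \<open>\<nu>\<close>.\<close>

lemma energy_ge_ground_energy:
  assumes u: "u \<in> ell2" "mass u \<le> \<nu>" "0 < \<nu>"
  shows "mass u / \<nu> * ground_energy J p \<nu> \<le> energy J p u"
    and "0 < mass u \<Longrightarrow> mass u < \<nu> \<Longrightarrow> mass u / \<nu> * ground_energy J p \<nu> < energy J p u"
proof -
  have t: "t \<le> t powr ((p + 1) / 2)" if "1 \<le> t" for t :: real
    using powr_mono[of 1 "(p + 1) / 2" t] that p by simp
  have t': "t < t powr ((p + 1) / 2)" if "1 < t" for t :: real
    using powr_less_mono[of 1 "(p + 1) / 2" t] that p by simp
  \<comment> \<open>The gain from scaling \<open>u\<close> up to mass \<open>\<nu>\<close>: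
    nonnegative, and positive when mass is missing, because (p + 1) / 2 > 1.\<close>
  define R where "R = ((\<nu> / mass u) powr ((p + 1) / 2) - \<nu> / mass u) * power_sum (p + 1) u / (p + 1)"
  have *: "mass u / \<nu> * ground_energy J p \<nu> \<le> energy J p u - mass u / \<nu> * R" if "0 < mass u"
    using mult_left_mono[OF energy_scaling[OF u(1) that less_imp_le[OF u(3)]], of "mass u / \<nu>"] that u(3)
    by (simp add: R_def[symmetric] right_diff_distrib)
  show "mass u / \<nu> * ground_energy J p \<nu> \<le> energy J p u"
  proof (cases "mass u = 0")
    case True
    then have "u = (\<lambda>n. 0)"
      using mass_pos[OF u(1)] by fastforce
    then show ?thesis
      using p energy_lower_bound[OF u(1)] True by simp
  next
    case False
    then have m: "0 < mass u"
      using mass_nonneg[of u] by simp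
    have "0 \<le> R"
      unfolding R_def using m u p t[of "\<nu> / mass u"] power_sum_nonneg[of "p + 1" u]
      by (intro divide_nonneg_nonneg mult_nonneg_nonneg) auto
    then have "0 \<le> mass u / \<nu> * R"
      using m u(3) by simp
    then show ?thesis
      using *[OF m] by linarith
  qed
  show "mass u / \<nu> * ground_energy J p \<nu> < energy J p u" if m: "0 < mass u" "mass u < \<nu>"
  proof -
    obtain n where "u n \<noteq> 0"
      using m(1) by (fastforce simp: mass_eq)
    then have "0 < power_sum (p + 1) u"
      using p by (intro power_sum_pos u(1)) auto
    then have "0 < R"
      unfolding R_def using m p t'[of "\<nu> / mass u"]
      by (intro divide_pos_pos mult_pos_pos) auto
    then have "0 < mass u / \<nu> * R"
      using m u(3) by simp
    then show ?thesis
      using *[OF m(1)] by linarith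
  qed
qed

section \<open>Existence of minimizers at negative ground energy\<close>

lemma minimizing_sequence:
  assumes \<nu>: "0 < \<nu>" and neg: "ground_energy J p \<nu> < 0"
  obtains u a where "\<And>k. u k \<in> ell2" "\<And>k. mass (u k) = \<nu>"
    "(\<lambda>k. energy J p (u k)) \<longlonglongrightarrow> ground_energy J p \<nu>" "0 < a" "\<And>k. a \<le> cmod (u k 0)"
proof -
  define I where "I = ground_energy J p \<nu>"
  \<comment> \<open>These constants satisfy \<open>a powr (p - 1) * \<nu> = c\<close>. If the
    modulus stayed below \<open>a\<close>, the nonlinear part of the energy would be at most
    \<open>- I / 2\<close>, so the energy would be at least \<open>I / 2\<close>.\<close>
  define c where "c = (p + 1) * (- I / 2)"
  define a where "a = (c / \<nu>) powr (1 / (p - 1))"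
  have I: "I < 0"
    using neg by (simp add: I_def)
  then have c: "0 < c"
    using p by (simp add: c_def mult_pos_neg)
  then have a: "0 < a"
    using \<nu> by (simp add: a_def)
  \<comment> \<open>The error \<open>(- I / 2) / Suc k\<close> tends to 0 and already at
    \<open>k = 0\<close> keeps the energy below \<open>I / 2\<close>.\<close>
  have "\<exists>u. u \<in> ell2 \<and> mass u = \<nu> \<and> energy J p u < I + (- I / 2) / Suc k" for k
  proof -
    have "\<exists>x\<in>{energy J p q | q. q \<in> ell2 \<and> mass q = \<nu>}. x < I + (- I / 2) / Suc k"
    proof (subst cInf_less_iff[symmetric])
      show "Inf {energy J p q | q. q \<in> ell2 \<and> mass q = \<nu>} < I + (- I / 2) / Suc k"
        using I by (simp add: I_def ground_energy_def divide_neg_pos)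
    qed (use ground_energy_set_nonempty energy_bdd_below \<nu> in auto)
    then show ?thesis
      by blast
  qed
  then obtain u where u: "\<And>k. u k \<in> ell2" "\<And>k. mass (u k) = \<nu>"
    and less: "\<And>k. energy J p (u k) < I + (- I / 2) / Suc k"
    by metis
  have "\<exists>n. a \<le> cmod (u k n)" for k
  proof (rule ccontr)
    assume "\<nexists>n. a \<le> cmod (u k n)"
    then have "power_sum (p + 1) (u k) \<le> a powr (p + 1 - 2) * mass (u k)"
      using p by (intro power_sum_le u) (auto simp: not_le intro: less_imp_le)
    also have "\<dots> = c"
      using p c \<nu> by (simp add: u a_def powr_powr)
    finally have "power_sum (p + 1) (u k) / (p + 1) \<le> - I / 2"
      using p by (simp add: c_def pos_divide_le_eq mult.commute)
    moreover have "(- I / 2) / Suc k \<le> - I / 2"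
      using I by (simp add: field_simps mult_nonpos_nonneg)
    then have "energy J p (u k) < I / 2"
      using less[of k] by linarith
    ultimately show False
      using dirichlet_nonneg[of "u k"] energy_eq[OF u(1)[of k]] by linarith
  qed
  then obtain b where b: "\<And>k. a \<le> cmod (u k (b k))"
    by metis
  \<comment> \<open>Translation brings a site of modulus at least \<open>a\<close> to the origin, so
    that a pointwise limit cannot vanish there.\<close>
  define v where "v k = (\<lambda>n. u k (n + b k))" for k
  have v: "v k \<in> ell2" "mass (v k) = \<nu>" "energy J p (v k) = energy J p (u k)" for k
    using u[of k] by (simp_all add: v_def ell2_shift mass_shift energy_eq dirichlet_shift power_sum_shift)
  have "(\<lambda>k. energy J p (v k)) \<longlonglongrightarrow> I"
  proof (rule tendsto_sandwich)
    show "\<forall>\<^sub>F k in sequentially. energy J p (v k) \<le> I + (- I / 2) / Suc k"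
      using less v(3) by (simp add: less_imp_le)
    show "\<forall>\<^sub>F k in sequentially. I \<le> energy J p (v k)"
      using ground_energy_le[OF v(1,2)] by (simp add: I_def)
    show "(\<lambda>k. I + (- I / 2) / Suc k) \<longlonglongrightarrow> I"
      using tendsto_add[OF tendsto_const LIMSEQ_Suc[OF lim_const_over_n], of I "- I / 2"] by simp
  qed auto
  then show thesis
    using v a b by (intro that[of v a]) (auto simp: I_def v_def)
qed

lemma exists_minimizer:
  assumes \<nu>: "0 < \<nu>" and neg: "ground_energy J p \<nu> < 0"
  shows "\<exists>q. is_minimizer J p \<nu> q"
proof -
  define I where "I = ground_energy J p \<nu>"
  obtain u a where u: "\<And>k. u k \<in> ell2" "\<And>k. mass (u k) = \<nu>"
    and E: "(\<lambda>k. energy J p (u k)) \<longlonglongrightarrow> I" and a: "0 < a" "\<And>k. a \<le> cmod (u k 0)"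
    using minimizing_sequence[OF assms] unfolding I_def by metis
  have "norm (u k n) \<le> sqrt \<nu>" for k n
    using cmod_le_sqrt_mass[OF u(1), of k n] u(2) by simp
  \<comment> \<open>The diagonal argument for uniformly bounded functions, as used for normal
    families, applied on the countable lattice.\<close>
  then obtain \<phi> where \<phi>: "strict_mono \<phi>" "\<And>n. \<exists>l. (\<lambda>k. u (\<phi> k) n) \<longlonglongrightarrow> l"
    using function_convergent_subsequence[of UNIV u "sqrt \<nu>"] by (metis UNIV_I uncountable_def countableI_type)
  obtain q where q: "\<And>n. (\<lambda>k. u (\<phi> k) n) \<longlonglongrightarrow> q n"
    using \<phi>(2) by metis
  define v where "v k = u (\<phi> k)" for k
  have v: "v k \<in> ell2" "mass (v k) = \<nu>" for k
    using u by (auto simp: v_def)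
  have Ev: "(\<lambda>k. energy J p (v k)) \<longlonglongrightarrow> I"
    using LIMSEQ_subseq_LIMSEQ[OF E \<phi>(1)] by (simp add: v_def o_def)
  have q_ell2: "q \<in> ell2" and q_mass: "mass q \<le> \<nu>"
    using ell2_pointwise_limit[of v \<nu> q] v q by (auto simp: v_def)
  have "a \<le> cmod (q 0)"
    using a(2) by (intro tendsto_lowerbound[OF tendsto_norm[OF q]]) auto
  then have q_pos: "0 < mass q"
    using a(1) by (intro mass_pos[of q 0] q_ell2) auto
  define r where "r k = (\<lambda>n. v k n - q n)" for k
  have r: "r k \<in> ell2" "mass (r k) \<le> 2 * \<nu> + 2 * mass q" for k
    using ell2_diff[OF v(1) q_ell2, of k] v(2)[of k] by (simp_all add: r_def)
  have r_lim: "(\<lambda>k. r k n) \<longlonglongrightarrow> 0" for n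
    unfolding r_def v_def using q by (rule LIM_zero)
  have v_eq: "v k = (\<lambda>n. q n + r k n)" for k
    by (simp add: r_def)
  have "(\<lambda>k. mass (v k) - mass (r k)) \<longlonglongrightarrow> mass q"
    unfolding v_eq by (rule mass_splitting[OF q_ell2 r r_lim])
  then have r_mass: "(\<lambda>k. mass (r k)) \<longlonglongrightarrow> \<nu> - mass q"
    using tendsto_diff[OF tendsto_const, of "\<lambda>k. mass (v k) - mass (r k)" _ _ \<nu>] by (simp add: v)
  have "(\<lambda>k. (dirichlet J (v k) - dirichlet J (r k)) / 2
      - (power_sum (p + 1) (v k) - power_sum (p + 1) (r k)) / (p + 1)) \<longlonglongrightarrow> energy J p q"
    unfolding v_eq energy_eq[OF q_ell2] using p
    by (intro tendsto_diff tendsto_divide tendsto_const dirichlet_splitting[OF q_ell2 r r_lim]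
        brezis_lieb[OF q_ell2 r r_lim]) auto
  moreover have "(dirichlet J (v k) - dirichlet J (r k)) / 2
      - (power_sum (p + 1) (v k) - power_sum (p + 1) (r k)) / (p + 1) = energy J p (v k) - energy J p (r k)" for k
    by (simp add: energy_eq v r diff_divide_distrib)
  ultimately have "(\<lambda>k. energy J p (v k) - energy J p (r k)) \<longlonglongrightarrow> energy J p q"
    by simp
  from tendsto_diff[OF Ev this] have r_energy: "(\<lambda>k. energy J p (r k)) \<longlonglongrightarrow> I - energy J p q"
    by simp
  have "(\<nu> - mass q) / \<nu> * I \<le> I - energy J p q"
  proof (rule tendsto_le[OF _ r_energy])
    show "(\<lambda>k. mass (r k) / \<nu> * I) \<longlonglongrightarrow> (\<nu> - mass q) / \<nu> * I"
      using \<nu> by (intro tendsto_intros r_mass) auto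
    \<comment> \<open>The limit of these masses is \<open>\<nu> - mass q\<close>, strictly below
      \<open>\<nu>\<close>. The bound by the share of the ground energy is valid only for mass at
      most \<open>\<nu>\<close>.\<close>
    have "\<forall>\<^sub>F k in sequentially. mass (r k) < \<nu>"
      using q_pos by (intro order_tendstoD(2)[OF r_mass]) auto
    then show "\<forall>\<^sub>F k in sequentially. mass (r k) / \<nu> * I \<le> energy J p (r k)"
      unfolding I_def by eventually_elim (rule energy_ge_ground_energy(1)[OF r(1) less_imp_le \<nu>])
  qed auto
  then have le: "energy J p q \<le> mass q / \<nu> * I"
    using \<nu> by (simp add: field_simps)
  \<comment> \<open>If \<open>mass q\<close> were smaller, the strict form of the same comparison
    would contradict \<open>le\<close>. Once the masses agree, \<open>le\<close> says that
    \<open>q\<close> attains the infimum.\<close>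
  then have "mass q = \<nu>"
    using energy_ge_ground_energy(2)[OF q_ell2 q_mass \<nu> q_pos] q_mass unfolding I_def by fastforce
  moreover have "energy J p q = I"
    using ground_energy_le[OF q_ell2 calculation] le \<nu> calculation by (simp add: I_def)
  ultimately show ?thesis
    using q_ell2 unfolding is_minimizer_def I_def by blast
qed

end

section \<open>Cubes and spheres in the lattice\<close>

definition cube :: "nat \<Rightarrow> (int ^ 'd::finite) set" where
  "cube K = {m. \<forall>i. m $ i \<in> {- int K..int K}}"

lemma cube_eq: "cube K = vec_lambda ` (UNIV \<rightarrow>\<^sub>E {- int K..int K})"
proof (intro set_eqI iffI)
  fix m :: "int ^ 'd"
  assume "m \<in> cube K"
  then have "vec_nth m \<in> UNIV \<rightarrow>\<^sub>E {- int K..int K}"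
    by (auto simp: cube_def)
  then show "m \<in> vec_lambda ` (UNIV \<rightarrow>\<^sub>E {- int K..int K})"
    by (metis image_eqI vec_nth_inverse)
qed (auto simp: cube_def PiE_iff)

lemma finite_cube: "finite (cube K)"
  unfolding cube_eq by (intro finite_imageI finite_PiE) auto

lemma card_cube: "card (cube K :: (int ^ 'd::finite) set) = (2 * K + 1) ^ CARD('d)"
proof -
  have "inj_on vec_lambda ((UNIV :: 'd set) \<rightarrow>\<^sub>E {- int K..int K})"
    by (rule inj_onI) (simp add: vec_lambda_inject)
  then show ?thesis
    unfolding cube_eq by (simp add: card_image card_PiE nat_add_distrib nat_mult_distrib)
qed

lemma cube_mono: "K \<le> L \<Longrightarrow> cube K \<subseteq> cube L"
  unfolding cube_def by (auto intro: order_trans[of "- int L" "- int K"] order_trans[of _ "int K"])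

lemma abs_component_le_l1_norm: "\<bar>m $ i\<bar> \<le> int (l1_norm m)"
proof -
  have "nat \<bar>m $ i\<bar> \<le> l1_norm m"
    unfolding l1_norm_def by (rule member_le_sum) auto
  then show ?thesis
    by linarith
qed

lemma l1_norm_eq_0_iff: "l1_norm m = 0 \<longleftrightarrow> m = 0"
  by (auto simp: l1_norm_def vec_eq_iff)

lemma l1_norm_le_cube:
  fixes m :: "int ^ 'd::finite"
  assumes "m \<in> cube K"
  shows "l1_norm m \<le> CARD('d) * K"
proof -
  have "l1_norm m \<le> (\<Sum>i\<in>(UNIV :: 'd set). K)"
    unfolding l1_norm_def using assms by (intro sum_mono) (simp add: cube_def nat_le_iff abs_le_iff minus_le_iff)
  then show ?thesis
    by simp
qed

text \<open>One unit step towards the origin in a nonzero coordinate; iterated, it gives a path of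
  \<open>l1_norm h\<close> unit steps from 0 to \<open>h\<close>.\<close>

lemma l1_norm_predecessor:
  assumes "l1_norm h = Suc k"
  obtains g e where "h = g + e" "l1_norm g = k" "l1_norm e = 1"
proof -
  have "h \<noteq> 0"
    using assms by (auto simp flip: l1_norm_eq_0_iff)
  then obtain i where i: "h $ i \<noteq> 0"
    by (auto simp: vec_eq_iff)
  define e where "e = axis i (sgn (h $ i))"
  have "l1_norm e = (\<Sum>j\<in>UNIV. if j = i then 1 else 0)"
    unfolding l1_norm_def e_def using i by (intro sum.cong) (auto simp: axis_def sgn_if)
  then have e: "l1_norm e = 1"
    by simp
  have "l1_norm h = nat \<bar>h $ i\<bar> + (\<Sum>j\<in>UNIV - {i}. nat \<bar>h $ j\<bar>)"
    unfolding l1_norm_def by (rule sum.remove) auto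
  moreover have "l1_norm (h - e) = nat \<bar>(h - e) $ i\<bar> + (\<Sum>j\<in>UNIV - {i}. nat \<bar>(h - e) $ j\<bar>)"
    unfolding l1_norm_def by (rule sum.remove) auto
  moreover have "(\<Sum>j\<in>UNIV - {i}. nat \<bar>(h - e) $ j\<bar>) = (\<Sum>j\<in>UNIV - {i}. nat \<bar>h $ j\<bar>)"
    by (intro sum.cong) (auto simp: e_def axis_def)
  moreover have "nat \<bar>h $ i\<bar> = Suc (nat \<bar>(h - e) $ i\<bar>)"
    using i by (auto simp: e_def axis_def sgn_if)
  ultimately have "l1_norm (h - e) = k"
    using assms by simp
  with e show thesis
    using that[of "h - e" e] by simp
qed

section \<open>Increments along paths\<close>

text \<open>Young's inequality with weight \<open>k\<close>, multiplied by \<open>k\<close> to avoid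
  division. With this weight the passage from the factor k^2 to (k + 1)^2 along a path is lossless,
  so it can stand in for Minkowski's inequality.\<close>

lemma mass_add_le:
  assumes ab: "a \<in> ell2" "b \<in> ell2" "(\<lambda>n. a n + b n) \<in> ell2" and k: "0 \<le> k"
  shows "k * mass (\<lambda>n. a n + b n) \<le> (k + 1) * mass a + k * (k + 1) * mass b"
proof -
  have pt: "k * (cmod (x + y))\<^sup>2 \<le> (k + 1) * (cmod x)\<^sup>2 + k * (k + 1) * (cmod y)\<^sup>2" for x y
  proof -
    have "k * (cmod (x + y))\<^sup>2 \<le> k * (cmod x + cmod y)\<^sup>2"
      using k by (intro mult_left_mono power_mono norm_triangle_ineq) auto
    also have "\<dots> = (k + 1) * (cmod x)\<^sup>2 + k * (k + 1) * (cmod y)\<^sup>2 - (cmod x - k * cmod y)\<^sup>2"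
      by (simp add: power2_eq_square algebra_simps)
    finally show ?thesis
      by (smt (verit) zero_le_power2)
  qed
  have "k * mass (\<lambda>n. a n + b n) = (\<Sum>\<^sub>\<infinity>n. k * (cmod (a n + b n))\<^sup>2)"
    by (simp add: mass_eq infsum_cmult_right')
  also have "\<dots> \<le> (\<Sum>\<^sub>\<infinity>n. (k + 1) * (cmod (a n))\<^sup>2 + k * (k + 1) * (cmod (b n))\<^sup>2)"
    by (intro infsum_mono pt summable_on_add summable_on_cmult_right ell2_summable[OF ab(1)]
        ell2_summable[OF ab(2)] ell2_summable[OF ab(3)])
  also have "\<dots> = (k + 1) * mass a + k * (k + 1) * mass b"
    unfolding mass_eq
    by (intro infsumI has_sum_add has_sum_cmult_right has_sum_infsum ell2_summable ab)
  finally show ?thesis .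
qed

text \<open>The square root of \<open>incr u\<close> is subadditive in the jump, and
  \<open>h\<close> is a sum of \<open>l1_norm h\<close> unit vectors.\<close>

lemma incr_le_l1_norm_sq:
  fixes u :: "int ^ 'd::finite \<Rightarrow> complex"
  assumes u: "u \<in> ell2" and B: "\<And>e. l1_norm e = 1 \<Longrightarrow> incr u e \<le> B"
  shows "incr u h \<le> (real (l1_norm h))\<^sup>2 * B"
proof (induction "l1_norm h" arbitrary: h)
  case 0
  then have "h = 0"
    by (simp add: l1_norm_eq_0_iff)
  then show ?case
    by (simp add: incr_def mass_eq l1_norm_def)
next
  case (Suc k)
  obtain g e where ge: "h = g + e" "l1_norm g = k" "l1_norm e = 1"
    using l1_norm_predecessor Suc(2) by metis
  show ?case
  proof (cases "k = 0")
    case True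
    then show ?thesis
      using B[OF ge(3)] ge by (simp add: l1_norm_eq_0_iff)
  next
    case False
    have split: "(\<lambda>n. u n - u (n + h)) = (\<lambda>n. (u n - u (n + g)) + (u (n + g) - u (n + g + e)))"
      by (simp add: ge(1) add.assoc)
    have s2: "(\<lambda>n. u (n + g) - u (n + g + e)) \<in> ell2"
      using ell2_shift[of "\<lambda>n. u n - u (n + e)" g] ell2_incr[OF u] by simp
    have m2: "mass (\<lambda>n. u (n + g) - u (n + g + e)) = incr u e"
      using mass_shift[of "\<lambda>n. u n - u (n + e)" g] by (simp add: incr_def)
    have "real k * incr u h \<le> (real k + 1) * incr u g + real k * (real k + 1) * incr u e"
      using mass_add_le[OF ell2_incr[OF u, of g] s2, of "real k"] ell2_incr[OF u, of h]
      by (simp add: incr_def[of u h] incr_def[of u g] split m2)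
    also have "\<dots> \<le> (real k + 1) * ((real k)\<^sup>2 * B) + real k * (real k + 1) * B"
      using Suc(1)[of g] ge B[OF ge(3)] by (intro add_mono mult_left_mono) auto
    also have "\<dots> = real k * ((real k + 1)\<^sup>2 * B)"
      by (simp add: power2_eq_square algebra_simps)
    finally show ?thesis
      using False Suc(2)[symmetric] by (simp add: add.commute)
  qed
qed

section \<open>The bottom of the spectrum is zero\<close>

lemma cube_indicator:
  fixes K :: nat and h :: "int ^ 'd::finite"
  defines "u \<equiv> \<lambda>n :: int ^ 'd::finite. if n \<in> cube K then 1 else (0::complex)"
  shows cube_indicator_ell2: "u \<in> ell2"
    and cube_indicator_mass: "mass u = real ((2 * K + 1) ^ CARD('d))"
    and cube_indicator_incr: "l1_norm h \<le> K \<Longrightarrow>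
      incr u h \<le> 2 * (real ((2 * K + 1) ^ CARD('d)) - real ((2 * (K - l1_norm h) + 1) ^ CARD('d)))"
proof -
  show u: "u \<in> ell2"
    by (rule ell2_if_finite_support)
      (auto simp: u_def finite_cube intro: finite_subset[of _ "cube K"])
  have "mass u = (\<Sum>\<^sub>\<infinity>n\<in>(cube K :: (int ^ 'd) set). 1)"
    unfolding mass_eq by (rule infsum_cong_neutral) (auto simp: u_def)
  then show "mass u = real ((2 * K + 1) ^ CARD('d))"
    by (simp add: finite_cube card_cube)
  assume h: "l1_norm h \<le> K"
  \<comment> \<open>The indicator changes under the jump \<open>h\<close> only when \<open>n\<close>
    or \<open>n + h\<close> lies in this boundary shell.\<close>
  define D :: "(int ^ 'd) set" where "D = cube K - cube (K - l1_norm h)"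
  define S where "S = D \<union> (\<lambda>n. n - h) ` D"
  have D: "finite D" "real (card D) = real ((2 * K + 1) ^ CARD('d)) - real ((2 * (K - l1_norm h) + 1) ^ CARD('d))"
  proof -
    show "finite D"
      by (simp add: D_def finite_cube)
    have "cube (K - l1_norm h) \<subseteq> (cube K :: (int ^ 'd) set)"
      by (rule cube_mono) auto
    then have "real (card D) = real (card (cube K :: (int ^ 'd) set)) - real (card (cube (K - l1_norm h) :: (int ^ 'd) set))"
      unfolding D_def by (subst card_Diff_subset) (auto simp: finite_cube of_nat_diff card_mono)
    then show "real (card D) = real ((2 * K + 1) ^ CARD('d)) - real ((2 * (K - l1_norm h) + 1) ^ CARD('d))"
      by (simp only: card_cube)
  qed
  have supp: "n \<in> S" if "u n \<noteq> u (n + h)" for n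
  proof (cases "n \<in> cube K")
    case True
    then have "n + h \<notin> cube K"
      using that by (auto simp: u_def)
    moreover have "n + h \<in> cube K" if "n \<in> cube (K - l1_norm h)"
      unfolding cube_def
    proof (clarify)
      fix i
      have "n $ i \<in> {- int (K - l1_norm h)..int (K - l1_norm h)}"
        using that by (simp add: cube_def)
      then show "(n + h) $ i \<in> {- int K..int K}"
        using abs_component_le_l1_norm[of h i] h by (auto simp: of_nat_diff)
    qed
    ultimately show ?thesis
      using True by (auto simp: S_def D_def)
  next
    case False
    then have nh: "n + h \<in> cube K"
      using that by (auto simp: u_def split: if_splits)
    have "n \<in> cube K" if "n + h \<in> cube (K - l1_norm h)"
      unfolding cube_def
    proof (clarify)
      fix i
      have "(n + h) $ i \<in> {- int (K - l1_norm h)..int (K - l1_norm h)}"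
        using that by (simp add: cube_def)
      then show "n $ i \<in> {- int K..int K}"
        using abs_component_le_l1_norm[of h i] h by (auto simp: of_nat_diff)
    qed
    then have "n + h \<in> D"
      using False nh by (auto simp: D_def)
    then have "n + h - h \<in> S"
      unfolding S_def by blast
    then show ?thesis
      by simp
  qed
  have "incr u h = (\<Sum>\<^sub>\<infinity>n\<in>S. (cmod (u n - u (n + h)))\<^sup>2)"
    unfolding incr_def mass_eq by (rule infsum_cong_neutral) (use supp in auto)
  also have "\<dots> = (\<Sum>n\<in>S. (cmod (u n - u (n + h)))\<^sup>2)"
    using D(1) by (simp add: S_def)
  also have "\<dots> \<le> (\<Sum>n\<in>S. 1)"
    by (intro sum_mono) (auto simp: u_def)
  also have "\<dots> \<le> real (card D) + real (card ((\<lambda>n. n - h) ` D))"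
    using card_Un_le[of D "(\<lambda>n. n - h) ` D"] by (simp add: S_def flip: of_nat_add)
  also have "\<dots> \<le> 2 * real (card D)"
    using card_image_le[OF D(1)] by simp
  finally show "incr u h \<le> 2 * (real ((2 * K + 1) ^ CARD('d)) - real ((2 * (K - l1_norm h) + 1) ^ CARD('d)))"
    using D(2) by simp
qed

context lattice_kernel
begin

text \<open>For a fixed jump the boundary shell of a large cube is a vanishing fraction of the cube.
  Jumps longer than the cube are covered by the uniform bound 4 on \<open>incr\<close> relative to
  the mass, together with summability of \<open>J\<close>.\<close>

lemma dirichlet_arbitrarily_small:
  assumes "0 < e"
  shows "\<exists>u\<in>ell2. 0 < mass u \<and> dirichlet J u < e * mass u"
proof -
  define u where "u K = (\<lambda>n :: int ^ 'd. if n \<in> cube K then 1 else (0::complex))" for K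
  define M where "M K = real ((2 * K + 1) ^ CARD('d))" for K
  have u: "u K \<in> ell2" "mass (u K) = M K" for K
    unfolding u_def M_def by (rule cube_indicator_ell2, rule cube_indicator_mass)
  have M: "0 < M K" for K
    by (simp add: M_def)
  have lim: "(\<lambda>K. incr (u K) h / M K) \<longlonglongrightarrow> 0" for h
  proof (rule Lim_null_comparison)
    have "(\<lambda>K. (2 * real K + 1 - 2 * real (l1_norm h)) / (2 * real K + 1)) \<longlonglongrightarrow> 1"
      by real_asymp
    then have "(\<lambda>K. 2 * (1 - ((2 * real K + 1 - 2 * real (l1_norm h)) / (2 * real K + 1)) ^ CARD('d))) \<longlonglongrightarrow> 2 * (1 - 1 ^ CARD('d))"
      by (intro tendsto_intros)
    then show "(\<lambda>K. 2 * (1 - ((2 * real K + 1 - 2 * real (l1_norm h)) / (2 * real K + 1)) ^ CARD('d))) \<longlonglongrightarrow> 0"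
      by simp
    show "\<forall>\<^sub>F K in sequentially. norm (incr (u K) h / M K)
        \<le> 2 * (1 - ((2 * real K + 1 - 2 * real (l1_norm h)) / (2 * real K + 1)) ^ CARD('d))"
      using eventually_ge_at_top[of "l1_norm h"]
    proof eventually_elim
      case (elim K)
      have "norm (incr (u K) h / M K) = incr (u K) h / M K"
        using incr_nonneg[of "u K" h] M[of K] by simp
      also have "\<dots> \<le> 2 * (M K - real ((2 * (K - l1_norm h) + 1) ^ CARD('d))) / M K"
        using cube_indicator_incr[OF elim] M[of K] unfolding u_def M_def
        by (intro divide_right_mono) auto
      also have "\<dots> = 2 * (1 - ((2 * real K + 1 - 2 * real (l1_norm h)) / (2 * real K + 1)) ^ CARD('d))"
      proof -
        have "real ((2 * (K - l1_norm h) + 1) ^ CARD('d)) = (2 * real K + 1 - 2 * real (l1_norm h)) ^ CARD('d)"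
          using elim by (simp add: of_nat_diff algebra_simps)
        moreover have "M K = (2 * real K + 1) ^ CARD('d)"
          by (simp add: M_def add.commute)
        ultimately show ?thesis
          using M[of K]
          by (simp only: power_divide) (simp add: diff_divide_distrib right_diff_distrib)
      qed
      finally show ?case .
    qed
  qed
  have "\<bar>incr (u K) h / M K\<bar> \<le> 4" for K h
    using incr_le[OF u(1), of K h] incr_nonneg[of "u K" h] M[of K] by (simp add: u(2) field_simps)
  then have "(\<lambda>K. \<Sum>\<^sub>\<infinity>h. J h * (incr (u K) h / M K)) \<longlonglongrightarrow> 0"
    by (rule tannery[OF J_summable J_nonneg _ lim])
  then have "\<forall>\<^sub>F K in sequentially. (\<Sum>\<^sub>\<infinity>h. J h * (incr (u K) h / M K)) < 2 * e"
    using assms by (intro order_tendstoD(2)) auto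
  then obtain K where K: "(\<Sum>\<^sub>\<infinity>h. J h * (incr (u K) h / M K)) < 2 * e"
    by (auto simp: eventually_sequentially)
  have "(\<Sum>\<^sub>\<infinity>h. J h * (incr (u K) h / M K)) = 2 * dirichlet J (u K) / M K"
    unfolding dirichlet_def divide_inverse mult.assoc[symmetric] infsum_cmult_left' by simp
  then have "2 * dirichlet J (u K) / M K < 2 * e"
    using K by (simp only:)
  then have "dirichlet J (u K) < e * M K"
    using M[of K] by (simp add: divide_less_eq)
  then show ?thesis
    using M[of K] u[of K] by (intro bexI[of _ "u K"]) auto
qed

lemma ground_energy_nonpos:
  assumes "0 < \<nu>"
  shows "ground_energy J p \<nu> \<le> 0"
proof (rule field_le_epsilon)
  fix e :: real
  assume "0 < e"
  then obtain u where u: "u \<in> ell2" "0 < mass u" "dirichlet J u < (2 * e / \<nu>) * mass u"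
    using dirichlet_arbitrarily_small[of "2 * e / \<nu>"] assms by auto
  define c where "c = complex_of_real (sqrt (\<nu> / mass u))"
  have c: "(cmod c)\<^sup>2 = \<nu> / mass u"
    using assms u(2) by (simp add: c_def)
  have "ground_energy J p \<nu> \<le> energy J p (\<lambda>n. c * u n)"
    using u assms by (intro ground_energy_le ell2_cmult) (simp_all add: mass_cmult c)
  also have "\<dots> \<le> (cmod c)\<^sup>2 * dirichlet J u / 2"
    using p power_sum_nonneg[of "p + 1" u] by (simp add: energy_cmult u(1))
  also have "\<dots> \<le> e"
    using u assms by (simp add: c field_simps)
  finally show "ground_energy J p \<nu> \<le> 0 + e"
    by simp
qed

end

section \<open>A Gagliardo--Nirenberg inequality\<close>

text \<open>For positive \<open>t\<close> and nonnegative \<open>x\<close> this is the length of the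
  part of [0, x] inside the layer [t / 2, t], as in the truncation method of Maz'ya. Subtracting
  \<open>t / 2\<close> makes small values vanish, which preserves square-summability.\<close>

definition truncate :: "real \<Rightarrow> real \<Rightarrow> real" where
  "truncate t x = max (t / 2) (min t x) - t / 2"

lemma truncate_mono: "x \<le> y \<Longrightarrow> truncate t x \<le> truncate t y"
  by (simp add: truncate_def min_def max_def)

lemma truncate_bounds: "0 < t \<Longrightarrow> 0 \<le> x \<Longrightarrow> 0 \<le> truncate t x \<and> truncate t x \<le> x"
  by (simp add: truncate_def min_def max_def)

lemma truncate_above: "0 < t \<Longrightarrow> t \<le> x \<Longrightarrow> truncate t x = t / 2"
  by (simp add: truncate_def min_def max_def)

text \<open>The dyadic truncations measure the parts of an interval inside disjoint dyadic layers.\<close>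

lemma sum_truncate_diff_le:
  fixes x y :: real and G :: "int set"
  assumes "y \<le> x" "finite G" "\<forall>j\<in>G. j \<le> L"
  shows "(\<Sum>j\<in>G. truncate (2 powr j) x - truncate (2 powr j) y) \<le> min x (2 powr L) - min y (2 powr L)"
  using assms(2,3)
\<comment> \<open>The cap \<open>2 powr L\<close> makes the induction work: the indices below the
  largest one \<open>b\<close> are covered up to height \<open>2 powr (b - 1)\<close>, exactly where
  layer \<open>b\<close> begins.\<close>
proof (induction G arbitrary: L rule: finite_linorder_max_induct)
  case empty
  show ?case
    using assms(1) by simp
next
  case (insert b G)
  have "(\<Sum>j\<in>G. truncate (2 powr j) x - truncate (2 powr j) y)
      \<le> min x (2 powr (b - 1)) - min y (2 powr (b - 1))"
    using insert.hyps(2) insert.IH[of "b - 1"] by fastforce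
  moreover have split: "min z (t / 2) + truncate t z = min z t" if "0 < t" for z t :: real
    using that by (auto simp: truncate_def min_def max_def)
  have "min z (2 powr (b - 1)) + truncate (2 powr b) z = min z (2 powr b)" for z :: real
    using split[of "2 powr b" z] by (simp add: powr_diff)
  then have "truncate (2 powr b) x - truncate (2 powr b) y
      = min x (2 powr b) - min y (2 powr b) - (min x (2 powr (b - 1)) - min y (2 powr (b - 1)))"
    by (smt (verit))
  moreover have mono: "min x s - min y s \<le> min x t - min y t" if "s \<le> t" for s t
    using that assms(1) by (auto simp: min_def)
  have "min x (2 powr b) - min y (2 powr b) \<le> min x (2 powr L) - min y (2 powr L)"
    using insert.prems by (intro mono) simp
  moreover have "b \<notin> G"
    using insert.hyps by auto
  ultimately show ?case
    using insert.hyps(1) by simp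
qed

text \<open>For a fixed pair of values all layer differences have the same sign, so the sum of their
  squares is at most the square of their sum.\<close>

lemma sum_truncate_diff_sq_le:
  fixes x y :: real and G :: "int set"
  assumes "finite G"
  shows "(\<Sum>j\<in>G. (truncate (2 powr j) x - truncate (2 powr j) y)\<^sup>2) \<le> (x - y)\<^sup>2"
proof -
  have *: "(\<Sum>j\<in>G. (truncate (2 powr j) x - truncate (2 powr j) y)\<^sup>2) \<le> (x - y)\<^sup>2"
    if "y \<le> x" for x y :: real
  proof -
    let ?d = "\<lambda>j::int. truncate (2 powr j) x - truncate (2 powr j) y"
    obtain L where L: "\<forall>j\<in>G. j \<le> L"
      using assms Max_ge by blast
    have d: "0 \<le> ?d j" for j
      using truncate_mono[OF that, of "2 powr j"] by simp
    have "(\<Sum>j\<in>G. ?d j) \<le> x - y"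
      using sum_truncate_diff_le[OF that assms L] that by (simp add: min_def split: if_splits)
    have "(\<Sum>j\<in>G. (?d j)\<^sup>2) \<le> (\<Sum>j\<in>G. ?d j * (\<Sum>i\<in>G. ?d i))"
      unfolding power2_eq_square
      using d by (intro sum_mono mult_left_mono member_le_sum assms) auto
    also have "\<dots> = (\<Sum>j\<in>G. ?d j)\<^sup>2"
      by (simp add: power2_eq_square sum_distrib_right)
    also have "\<dots> \<le> (x - y)\<^sup>2"
      using \<open>(\<Sum>j\<in>G. ?d j) \<le> x - y\<close> d by (intro power_mono sum_nonneg) auto
    finally show ?thesis .
  qed
  show ?thesis
    using *[of y x] *[of x y] by (cases "y \<le> x") (simp_all add: power2_commute)
qed

lemma sum_infsum_le:
  fixes f :: "'i \<Rightarrow> 'a \<Rightarrow> real"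
  assumes "finite G" "\<And>j. j \<in> G \<Longrightarrow> f j summable_on A" "g summable_on A"
    and "\<And>x. x \<in> A \<Longrightarrow> (\<Sum>j\<in>G. f j x) \<le> g x"
  shows "(\<Sum>j\<in>G. infsum (f j) A) \<le> infsum g A"
proof -
  have "((\<lambda>x. \<Sum>j\<in>G. f j x) has_sum (\<Sum>j\<in>G. infsum (f j) A)) A"
    using assms(1,2) by (induction G rule: finite_induct) (auto intro!: has_sum_add)
  then show ?thesis
    using has_sum_mono[OF _ has_sum_infsum[OF assms(3)] assms(4)] by blast
qed

context symmetric_kernel
begin

text \<open>The layer estimate is applied to the moduli at \<open>n\<close> and \<open>n + h\<close>
  and summed over both. The absence of a factor depending on \<open>G\<close> is what later turns
  the weak-type estimate into a strong one.\<close>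

lemma sum_dirichlet_truncate_le:
  fixes u :: "'a \<Rightarrow> complex" and G :: "int set"
  assumes u: "u \<in> ell2" and G: "finite G"
  shows "(\<Sum>j\<in>G. dirichlet J (\<lambda>n. of_real (truncate (2 powr j) (cmod (u n))))) \<le> dirichlet J u"
proof -
  define v where "v j = (\<lambda>n. complex_of_real (truncate (2 powr j) (cmod (u n))))" for j :: int
  have v: "v j \<in> ell2" for j
    using truncate_bounds[of "2 powr j"] by (intro ell2_mono[OF u]) (simp add: v_def)
  have incr: "(\<Sum>j\<in>G. incr (v j) h) \<le> incr u h" for h
    unfolding incr_def mass_eq
  proof (rule sum_infsum_le[OF G])
    show "(\<lambda>n. (cmod (v j n - v j (n + h)))\<^sup>2) summable_on UNIV" for j
      by (intro ell2_summable ell2_incr v)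
    show "(\<lambda>n. (cmod (u n - u (n + h)))\<^sup>2) summable_on UNIV"
      by (intro ell2_summable ell2_incr u)
    fix n
    have "(\<Sum>j\<in>G. (cmod (v j n - v j (n + h)))\<^sup>2) \<le> (cmod (u n) - cmod (u (n + h)))\<^sup>2"
      using sum_truncate_diff_sq_le[OF G, of "cmod (u n)" "cmod (u (n + h))"]
      by (simp add: v_def flip: of_real_diff)
    also have "\<dots> \<le> (cmod (u n - u (n + h)))\<^sup>2"
      using norm_triangle_ineq3[of "u n" "u (n + h)"] by (simp flip: abs_le_square_iff)
    finally show "(\<Sum>j\<in>G. (cmod (v j n - v j (n + h)))\<^sup>2) \<le> (cmod (u n - u (n + h)))\<^sup>2" .
  qed
  have "(\<Sum>j\<in>G. \<Sum>\<^sub>\<infinity>h. J h * incr (v j) h) \<le> (\<Sum>\<^sub>\<infinity>h. J h * incr u h)"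
    using mult_left_mono[OF incr J_nonneg]
    by (intro sum_infsum_le[OF G] summable_incr u v) (simp add: sum_distrib_left)
  then show ?thesis
    by (simp add: dirichlet_def v_def sum_divide_distrib[symmetric] divide_right_mono)
qed

end

text \<open>The weights average over a region of diameter of order \<open>K\<close>, so that the mean square
  deviation from the average is controlled by \<open>K powr \<gamma>\<close> times the Dirichlet form.\<close>

definition averaging :: "(int ^ 'd::finite \<Rightarrow> real) \<Rightarrow> real \<Rightarrow> real \<Rightarrow> nat \<Rightarrow> bool" where
  "averaging J \<gamma> C K \<longleftrightarrow> (\<exists>A w. finite A \<and> (\<forall>m\<in>A. 0 \<le> w m \<and> w m \<le> C / real K ^ CARD('d)) \<and>
     (\<Sum>m\<in>A. w m) = 1 \<and>
     (\<forall>u\<in>ell2. (\<Sum>m\<in>A. w m * incr u m) \<le> C * real K powr \<gamma> * dirichlet J u))"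

section \<open>Averaging weights supplied by the kernel\<close>

context lattice_kernel
begin

text \<open>Uniform weights on the cube: every site of it is reached by at most
  \<open>CARD('d) * K\<close> unit steps, so increments cost the square of that length. This gives
  \<gamma> = 2; the maximum with 1 in the constant serves the bound on the weights.\<close>

lemma averaging_nearest_neighbour:
  assumes c: "0 < c" and J: "\<And>e. l1_norm e = 1 \<Longrightarrow> c \<le> J e" and K: "1 \<le> K"
  shows "averaging J 2 (max 1 (2 * (real CARD('d))\<^sup>2 / c)) K"
proof -
  define C where "C = max 1 (2 * (real CARD('d))\<^sup>2 / c)"
  define A :: "(int ^ 'd) set" where "A = cube K"
  have A: "finite A" "card A = (2 * K + 1) ^ CARD('d)"
    by (auto simp: A_def finite_cube card_cube)
  have "real K ^ CARD('d) \<le> (2 * real K + 1) ^ CARD('d)"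
    by (intro power_mono) auto
  then have "1 / real (card A) \<le> 1 / real K ^ CARD('d)"
    using K by (intro divide_left_mono) (auto simp: A)
  also have "\<dots> \<le> C / real K ^ CARD('d)"
    by (intro divide_right_mono) (auto simp: C_def)
  finally have w: "1 / real (card A) \<le> C / real K ^ CARD('d)" .
  have incr: "incr u m \<le> C * real K powr 2 * dirichlet J u" if u: "u \<in> ell2" and m: "m \<in> A" for u m
  proof -
    have "incr u e \<le> 2 * dirichlet J u / c" if "l1_norm e = 1" for e
    proof -
      have "c * incr u e \<le> J e * incr u e"
        by (intro mult_right_mono J that incr_nonneg)
      also have "\<dots> \<le> 2 * dirichlet J u"
        using sum_incr_le_dirichlet[OF u, of "{e}"] by simp
      finally show ?thesis
        using c by (simp add: pos_le_divide_eq mult.commute)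
    qed
    then have "incr u m \<le> (real (l1_norm m))\<^sup>2 * (2 * dirichlet J u / c)"
      by (rule incr_le_l1_norm_sq[OF u])
    also have "\<dots> \<le> (real (CARD('d) * K))\<^sup>2 * (2 * dirichlet J u / c)"
      using m c dirichlet_nonneg[of u]
      by (intro mult_right_mono power_mono of_nat_mono l1_norm_le_cube) (auto simp: A_def)
    also have "\<dots> = (2 * (real CARD('d))\<^sup>2 / c) * ((real K)\<^sup>2 * dirichlet J u)"
      by (simp add: power_mult_distrib)
    also have "\<dots> \<le> C * ((real K)\<^sup>2 * dirichlet J u)"
      using dirichlet_nonneg[of u] by (intro mult_right_mono) (auto simp: C_def)
    finally show ?thesis
      using K by (simp add: mult.assoc)
  qed
  have "(\<Sum>m\<in>A. 1 / real (card A) * incr u m) \<le> C * real K powr 2 * dirichlet J u" if "u \<in> ell2" for u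
  proof -
    have "(\<Sum>m\<in>A. 1 / real (card A) * incr u m) \<le> (\<Sum>m\<in>A. 1 / real (card A) * (C * real K powr 2 * dirichlet J u))"
      by (intro sum_mono mult_left_mono incr that) auto
    also have "\<dots> = C * real K powr 2 * dirichlet J u"
      using A by simp
    finally show ?thesis .
  qed
  then show ?thesis
    unfolding averaging_def C_def[symmetric] using A w
    by (intro exI[of _ A] exI[of _ "\<lambda>_. 1 / real (card A)"]) auto
qed

text \<open>For a heavy tail the averaging weights are \<open>J\<close> itself on a dyadic annulus: the upper bound on
  \<open>J\<close> and the lower bound on its sums over spheres make them comparable to uniform weights.\<close>

lemma averaging_heavy_tail:
  fixes \<eta> :: "nat \<Rightarrow> real" and a :: real
  assumes const: "0 < C1" "0 < C2" "0 < cp" "0 < cm" "0 < a"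
    and lower: "\<And>k. K \<le> k \<Longrightarrow> C1 \<le> real k powr (real CARD('d) + a) * \<eta> k"
    and upper: "\<And>k. K \<le> k \<Longrightarrow> real k powr (real CARD('d) + a) * \<eta> k \<le> C2"
    and J_upper: "\<And>n. K \<le> l1_norm n \<Longrightarrow> J n \<le> cp * \<eta> (l1_norm n)"
    and J_lower: "\<And>k. K \<le> k \<Longrightarrow> cm * real k ^ (CARD('d) - 1) * \<eta> k \<le> (\<Sum>m\<in>l1_sphere k. J m)"
    and K: "1 \<le> K"
  shows "averaging J a ((cp * C2 + 2) / (cm * C1 / 2 powr (1 + a))) K"
proof -
  define d where "d = CARD('d)"
  define c where "c = cm * C1 / 2 powr (1 + a)"
  \<comment> \<open>The dyadic annulus between radii \<open>K\<close> and \<open>2 * K\<close>: all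
    powers of the radius are comparable on it, and it consists of exactly \<open>K\<close>
    spheres.\<close>
  define A where "A = (\<Union>k\<in>{K..<2 * K}. l1_sphere k :: (int ^ 'd) set)"
  define W where "W = (\<Sum>m\<in>A. J m)"
  have d: "1 \<le> d"
    by (simp add: d_def Suc_le_eq)
  have c: "0 < c"
    using const by (simp add: c_def)
  have A: "finite A"
    by (simp add: A_def finite_l1_sphere)
  have A_norm: "K \<le> l1_norm m" if "m \<in> A" for m
    using that by (auto simp: A_def l1_sphere_def)
  have sphere: "cm * C1 * (2 * real K) powr (- 1 - a) \<le> (\<Sum>m\<in>(l1_sphere k :: (int ^ 'd) set). J m)"
    if "k \<in> {K..<2 * K}" for k
  proof -
    have k: "0 < real k" "real k \<le> 2 * real K" "K \<le> k"
      using that K by auto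
    have "cm * C1 * (2 * real K) powr (- 1 - a) \<le> cm * C1 * real k powr (- 1 - a)"
      using k const by (intro mult_left_mono powr_mono2') auto
    also have "\<dots> \<le> cm * (real k powr (real d + a) * \<eta> k) * real k powr (- 1 - a)"
      using const lower[OF k(3)] by (intro mult_right_mono mult_left_mono) (auto simp: d_def)
    also have "\<dots> = cm * real k powr (real (d - 1)) * \<eta> k"
      using d by (simp add: powr_add[symmetric] of_nat_diff mult_ac)
    also have "\<dots> = cm * real k ^ (d - 1) * \<eta> k"
      using k by (simp add: powr_realpow)
    also have "\<dots> \<le> (\<Sum>m\<in>l1_sphere k. J m)"
      using J_lower[OF k(3)] by (simp add: d_def)
    finally show ?thesis .
  qed
  have W: "c * real K powr (- a) \<le> W"
  proof -
    \<comment> \<open>Each of the \<open>K\<close> spheres contributes at least the bound at the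
      outer radius \<open>2 * K\<close>, hence the factor \<open>2 powr (1 + a)\<close> in
      \<open>c\<close>.\<close>
    have "c * real K powr (- a) = real K * (cm * C1 * (2 * real K) powr (- 1 - a))"
      using K by (simp add: c_def powr_mult powr_minus powr_diff powr_add field_simps)
    also have "\<dots> = (\<Sum>k\<in>{K..<2 * K}. cm * C1 * (2 * real K) powr (- 1 - a))"
      by simp
    also have "\<dots> \<le> (\<Sum>k\<in>{K..<2 * K}. \<Sum>m\<in>l1_sphere k. J m)"
      by (intro sum_mono sphere)
    also have "\<dots> = W"
      unfolding W_def A_def
      by (intro sum.UNION_disjoint[symmetric]) (simp_all add: finite_l1_sphere, auto simp: l1_sphere_def)
    finally show ?thesis .
  qed
  have cK: "0 < c * real K powr (- a)"
    using c K by simp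
  then have W_pos: "0 < W"
    using W by linarith
  have inv_W: "1 / W \<le> real K powr a / c"
  proof -
    have "1 / W \<le> 1 / (c * real K powr (- a))"
      using W cK by (intro divide_left_mono) auto
    then show ?thesis
      by (simp add: powr_minus field_simps)
  qed
  have J_le: "J m \<le> cp * C2 * real K powr (- real d - a)" if "m \<in> A" for m
  proof -
    let ?k = "l1_norm m"
    have k: "K \<le> ?k" "0 < real ?k"
      using A_norm[OF that] K by auto
    have "\<eta> ?k = (real ?k powr (real d + a) * \<eta> ?k) * real ?k powr (- real d - a)"
      using k by (simp add: powr_add[symmetric] mult_ac)
    also have "\<dots> \<le> C2 * real ?k powr (- real d - a)"
      using upper[OF k(1)] by (intro mult_right_mono) (auto simp: d_def)
    also have "\<dots> \<le> C2 * real K powr (- real d - a)"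
      using k K const by (intro mult_left_mono powr_mono2') auto
    finally show ?thesis
      using order_trans[OF J_upper[OF k(1)]] const by (simp add: mult.assoc)
  qed
  have bound: "J m / W \<le> (cp * C2 + 2) / c / real K ^ d" if "m \<in> A" for m
  proof -
    have "J m / W \<le> (cp * C2 * real K powr (- real d - a)) * (real K powr a / c)"
      using mult_mono[OF J_le[OF that] inv_W] W_pos const by simp
    also have "\<dots> = cp * C2 / c / real K ^ d"
    proof -
      have "real K powr (- real d - a) * real K powr a = inverse (real K ^ d)"
        using K by (simp add: powr_add[symmetric] powr_minus powr_realpow)
      then show ?thesis
        by (simp add: divide_inverse mult_ac)
    qed
    \<comment> \<open>One constant serves both requirements: \<open>cp * C2\<close> bounds the
      weights, and the summand 2 undoes the factor 1/2 in the Dirichlet form.\<close>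
    also have "\<dots> \<le> (cp * C2 + 2) / c / real K ^ d"
      using c by (intro divide_right_mono) auto
    finally show ?thesis .
  qed
  have "(\<Sum>m\<in>A. J m / W * incr u m) \<le> (cp * C2 + 2) / c * real K powr a * dirichlet J u"
    if u: "u \<in> ell2" for u
  proof -
    have "(\<Sum>m\<in>A. J m / W * incr u m) = (1 / W) * (\<Sum>m\<in>A. J m * incr u m)"
      by (simp add: sum_divide_distrib)
    also have "\<dots> \<le> (real K powr a / c) * (2 * dirichlet J u)"
      using W_pos c by (intro mult_mono inv_W sum_incr_le_dirichlet u A sum_nonneg
          mult_nonneg_nonneg J_nonneg incr_nonneg) auto
    also have "\<dots> = 2 / c * (real K powr a * dirichlet J u)"
      by simp
    also have "\<dots> \<le> (cp * C2 + 2) / c * (real K powr a * dirichlet J u)"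
      using c const dirichlet_nonneg[of u] by (intro mult_right_mono divide_right_mono) auto
    finally show ?thesis
      by (simp add: mult.assoc)
  qed
  moreover have "(\<Sum>m\<in>A. J m / W) = 1"
    using W_pos by (simp add: W_def flip: sum_divide_distrib)
  ultimately show ?thesis
    unfolding averaging_def c_def[symmetric] d_def[symmetric] using A bound W_pos J_nonneg
    by (intro exI[of _ A] exI[of _ "\<lambda>m. J m / W"]) auto
qed

end

section \<open>From averaging weights to the Gagliardo--Nirenberg inequality\<close>

context lattice_kernel
begin

text \<open>The truncation equals \<open>t / 2\<close> on \<open>F\<close>, while its weighted mean
  square around any site is at most \<open>C * M / K ^ d\<close>. For large enough \<open>K\<close>
  most of \<open>t / 2\<close> is therefore increment, and summing over \<open>F\<close> charges it
  to the Dirichlet form of the truncation alone.\<close>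

lemma level_set_bound:
  fixes \<gamma> C :: real and K0 :: nat
  assumes avg: "\<And>K. K0 \<le> K \<Longrightarrow> averaging J \<gamma> C K" and \<gamma>: "0 \<le> \<gamma>" and C: "0 \<le> C"
  obtains D where "0 < D"
    "\<And>u t F. u \<in> ell2 \<Longrightarrow> 0 < t \<Longrightarrow> finite F \<Longrightarrow> (\<And>n. n \<in> F \<Longrightarrow> t \<le> cmod (u n)) \<Longrightarrow>
      real (card F) * t powr (2 + 2 * \<gamma> / real CARD('d))
        \<le> D * mass u powr (\<gamma> / real CARD('d)) * dirichlet J (\<lambda>n. of_real (truncate t (cmod (u n))))"
proof
  define d where "d = CARD('d)"
  \<comment> \<open>With \<open>K\<close> between \<open>B * x\<close> and \<open>2 * B * x\<close>,
    where \<open>x ^ d = M / t^2\<close> and \<open>x \<ge> 1\<close>, this ensures both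
    \<open>K0 \<le> K\<close> and \<open>16 * C * M / t^2 \<le> K ^ d\<close>.\<close>
  define B where "B = max (real K0) (max 1 (16 * C))"
  have d: "0 < d"
    by (simp add: d_def)
  have B: "1 \<le> B" "real K0 \<le> B" "16 * C \<le> B"
    by (auto simp: B_def)
  show "0 < 16 * (C + 1) * (2 * B) powr \<gamma>"
    using B C by simp
  fix u :: "int ^ 'd \<Rightarrow> complex" and t F
  assume u: "u \<in> ell2" and t: "0 < t" and F: "finite F" "\<And>n. n \<in> F \<Longrightarrow> t \<le> cmod (u n)"
  define v where "v = (\<lambda>n. complex_of_real (truncate t (cmod (u n))))"
  define M where "M = mass u"
  define Q where "Q = dirichlet J v"
  have Q: "0 \<le> Q"
    by (simp add: Q_def dirichlet_nonneg)
  have v_le: "cmod (v n) \<le> cmod (u n)" for n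
    using truncate_bounds[OF t, of "cmod (u n)"] by (simp add: v_def)
  have v: "v \<in> ell2" and v_mass: "mass v \<le> M"
    using ell2_mono[OF u v_le] by (auto simp: M_def)
  have v_F: "(cmod (v n))\<^sup>2 = t\<^sup>2 / 4" if "n \<in> F" for n
    by (simp add: v_def truncate_above[OF t F(2)[OF that]] power_divide)
  have "real (card F) * t powr (2 + 2 * \<gamma> / real d) \<le> 16 * (C + 1) * (2 * B) powr \<gamma> * M powr (\<gamma> / real d) * Q"
  proof (cases "F = {}")
    case True
    then show ?thesis
      using Q C by simp
  next
    case False
    then obtain n0 where "n0 \<in> F" by blast
    then have "t\<^sup>2 \<le> (cmod (u n0))\<^sup>2"
      using F(2) t by (intro power_mono) auto
    \<comment> \<open>Nonemptiness of \<open>F\<close> enters here: without \<open>X \<ge> 1\<close>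
      the scale \<open>B * x\<close> could drop below \<open>K0\<close>.\<close>
    then have tM: "t\<^sup>2 \<le> M"
      using norm_sq_le_mass[OF u, of n0] by (simp add: M_def)
    define X where "X = M / t\<^sup>2"
    have X: "1 \<le> X"
      using tM t by (simp add: X_def)
    define x where "x = X powr (1 / real d)"
    have x: "1 \<le> x" "x ^ d = X"
      using X d by (auto simp: x_def ge_one_powr_ge_zero powr_realpow[symmetric] powr_powr)
    define K where "K = nat \<lceil>B * x\<rceil>"
    have Bx: "1 \<le> B * x"
      using B x mult_mono[of 1 B 1 x] by simp
    have K_ge: "B * x \<le> real K"
      using Bx by (simp add: K_def)
    have K_le: "real K \<le> 2 * B * x"
    proof -
      have "real K = of_int \<lceil>B * x\<rceil>"
        unfolding K_def using Bx by (intro of_nat_nat) linarith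
      then show ?thesis
        using Bx by linarith
    qed
    have "real K0 \<le> real K"
      using B(1,2) x(1) K_ge mult_mono[of "real K0" B 1 x] by simp
    then obtain A w where A: "finite A" and w: "\<And>m. m \<in> A \<Longrightarrow> 0 \<le> w m"
        "\<And>m. m \<in> A \<Longrightarrow> w m \<le> C / real K ^ d" "(\<Sum>m\<in>A. w m) = 1"
      and wi: "(\<Sum>m\<in>A. w m * incr v m) \<le> C * real K powr \<gamma> * Q"
      using avg[of K] v unfolding averaging_def d_def Q_def by auto
    have KX: "16 * C * X \<le> real K ^ d"
    proof -
      have "16 * C * X \<le> B ^ d * x ^ d"
        using B X d x(2) self_le_power[of B d] by (intro mult_mono) auto
      also have "\<dots> \<le> real K ^ d"
        using K_ge Bx unfolding power_mult_distrib[symmetric] by (intro power_mono) auto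
      finally show ?thesis .
    qed
    have K_pos: "0 < real K ^ d"
      using K_ge Bx by simp
    have CM: "C / real K ^ d * M \<le> t\<^sup>2 / 16"
    proof -
      have "16 * C * M \<le> real K ^ d * t\<^sup>2"
        using KX t by (simp add: X_def field_simps)
      then show ?thesis
        using K_pos by (simp add: field_simps)
    qed
    \<comment> \<open>Of \<open>t^2 / 4\<close> the neighbouring values absorb at most twice
      \<open>t^2 / 16\<close>; the increments must supply the remaining
      \<open>t^2 / 8\<close>.\<close>
    have point: "t\<^sup>2 / 8 \<le> 2 * (\<Sum>m\<in>A. w m * (cmod (v n - v (n + m)))\<^sup>2)" if n: "n \<in> F" for n
    proof -
      have "t\<^sup>2 / 4 = (\<Sum>m\<in>A. w m * (cmod (v n))\<^sup>2)"
        using w(3) v_F[OF n] by (simp flip: sum_distrib_right)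
      also have "\<dots> \<le> (\<Sum>m\<in>A. 2 * (w m * (cmod (v n - v (n + m)))\<^sup>2) + 2 * (C / real K ^ d * (cmod (v (n + m)))\<^sup>2))"
      proof (rule sum_mono)
        fix m
        assume m: "m \<in> A"
        have "w m * (cmod (v n))\<^sup>2 \<le> w m * (2 * (cmod (v n - v (n + m)))\<^sup>2 + 2 * (cmod (v (n + m)))\<^sup>2)"
          using norm_add_sq_le[of "v n - v (n + m)" "v (n + m)"] w(1)[OF m] by (intro mult_left_mono) auto
        also have "\<dots> \<le> 2 * (w m * (cmod (v n - v (n + m)))\<^sup>2) + 2 * (C / real K ^ d * (cmod (v (n + m)))\<^sup>2)"
          using mult_right_mono[OF w(2)[OF m], of "(cmod (v (n + m)))\<^sup>2"] by (simp add: distrib_left)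
        finally show "w m * (cmod (v n))\<^sup>2 \<le> \<dots>" .
      qed
      also have "\<dots> = 2 * (\<Sum>m\<in>A. w m * (cmod (v n - v (n + m)))\<^sup>2)
          + 2 * (C / real K ^ d * (\<Sum>m\<in>A. (cmod (v (n + m)))\<^sup>2))"
        by (simp only: sum.distrib sum_distrib_left)
      also have "(\<Sum>m\<in>A. (cmod (v (n + m)))\<^sup>2) \<le> M"
      proof -
        have "(\<lambda>m. v (m + n)) \<in> ell2" "mass (\<lambda>m. v (m + n)) \<le> M"
          using v v_mass by (simp_all add: ell2_shift mass_shift)
        then show ?thesis
          using sum_norm_sq_le_mass[of "\<lambda>m. v (m + n)" A] A by (simp add: add.commute)
      qed
      then have "C / real K ^ d * (\<Sum>m\<in>A. (cmod (v (n + m)))\<^sup>2) \<le> C / real K ^ d * M"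
        using C by (intro mult_left_mono) auto
      finally show ?thesis
        using CM by linarith
    qed
    have "real (card F) * (t\<^sup>2 / 8) \<le> (\<Sum>n\<in>F. 2 * (\<Sum>m\<in>A. w m * (cmod (v n - v (n + m)))\<^sup>2))"
      using sum_mono[OF point, of F] by simp
    also have "\<dots> = 2 * (\<Sum>m\<in>A. w m * (\<Sum>n\<in>F. (cmod (v n - v (n + m)))\<^sup>2))"
      by (simp only: sum_distrib_left[symmetric] sum.swap[of _ F A]) (simp only: sum_distrib_left sum.swap[of _ A F])
    also have "\<dots> \<le> 2 * (\<Sum>m\<in>A. w m * incr v m)"
      unfolding incr_def using w(1)
      by (intro mult_left_mono sum_mono sum_norm_sq_le_mass ell2_incr v F(1)) auto
    also have "\<dots> \<le> 2 * (C * real K powr \<gamma> * Q)"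
      using wi by simp
    \<comment> \<open>Replacing \<open>C\<close> by \<open>C + 1\<close> keeps the final constant
      positive even for \<open>C = 0\<close>.\<close>
    also have "\<dots> \<le> 2 * ((C + 1) * ((2 * B) powr \<gamma> * X powr (\<gamma> / real d)) * Q)"
    proof -
      have "real K powr \<gamma> \<le> (2 * B * x) powr \<gamma>"
        using K_le \<gamma> by (intro powr_mono2) auto
      also have "\<dots> = (2 * B) powr \<gamma> * X powr (\<gamma> / real d)"
        using B X by (simp add: powr_mult x_def powr_powr)
      finally show ?thesis
        using C Q by (intro mult_left_mono mult_right_mono mult_mono) auto
    qed
    finally have "real (card F) * t\<^sup>2 \<le> 16 * (C + 1) * (2 * B) powr \<gamma> * X powr (\<gamma> / real d) * Q"
      by (simp add: algebra_simps)
    then have "real (card F) * t\<^sup>2 * t powr (2 * \<gamma> / real d)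
        \<le> 16 * (C + 1) * (2 * B) powr \<gamma> * X powr (\<gamma> / real d) * Q * t powr (2 * \<gamma> / real d)"
      by (intro mult_right_mono) auto
    then have "real (card F) * (t\<^sup>2 * t powr (2 * \<gamma> / real d))
        \<le> 16 * (C + 1) * (2 * B) powr \<gamma> * (X powr (\<gamma> / real d) * t powr (2 * \<gamma> / real d)) * Q"
      by (simp only: mult_ac)
    moreover have "X powr (\<gamma> / real d) * t powr (2 * \<gamma> / real d) = M powr (\<gamma> / real d)"
    proof -
      have "t powr (2 * \<gamma> / real d) = (t\<^sup>2) powr (\<gamma> / real d)"
        using t by (simp add: powr_powr flip: powr_numeral)
      then show ?thesis
        using t X by (simp add: X_def flip: powr_mult)
    qed
    moreover have "t\<^sup>2 * t powr (2 * \<gamma> / real d) = t powr (2 + 2 * \<gamma> / real d)"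
      using t by (simp add: powr_add)
    ultimately show ?thesis
      by (simp only:)
  qed
  then show "real (card F) * t powr (2 + 2 * \<gamma> / real CARD('d))
    \<le> 16 * (C + 1) * (2 * B) powr \<gamma> * mass u powr (\<gamma> / real CARD('d))
      * dirichlet J (\<lambda>n. of_real (truncate t (cmod (u n))))"
    by (simp add: d_def M_def Q_def v_def)
qed

text \<open>In the level-set bounds only the Dirichlet form depends on the level; the factor
  \<open>mass u powr (\<gamma> / d)\<close> is common to all levels. The Dirichlet forms of the
  layers add up to at most that of \<open>u\<close>.\<close>

lemma gagliardo_nirenberg_critical:
  fixes \<gamma> C :: real and K0 :: nat
  assumes avg: "\<And>K. K0 \<le> K \<Longrightarrow> averaging J \<gamma> C K" and \<gamma>: "0 \<le> \<gamma>" and C: "0 \<le> C"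
  obtains D where "0 < D"
    "\<And>u. u \<in> ell2 \<Longrightarrow> power_sum (2 + 2 * \<gamma> / real CARD('d)) u
      \<le> D * mass u powr (\<gamma> / real CARD('d)) * dirichlet J u"
proof -
  define s where "s = 2 + 2 * \<gamma> / real CARD('d)"
  have s: "2 \<le> s"
    using \<gamma> by (simp add: s_def)
  obtain D where D: "0 < D" and level:
    "\<And>u t F. u \<in> ell2 \<Longrightarrow> 0 < t \<Longrightarrow> finite F \<Longrightarrow> (\<And>n. n \<in> F \<Longrightarrow> t \<le> cmod (u n)) \<Longrightarrow>
      real (card F) * t powr s
        \<le> D * mass u powr (\<gamma> / real CARD('d)) * dirichlet J (\<lambda>n. of_real (truncate t (cmod (u n))))"
    using level_set_bound[OF avg \<gamma> C] unfolding s_def by metis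
  have "power_sum s u \<le> 2 powr s * D * mass u powr (\<gamma> / real CARD('d)) * dirichlet J u"
    if u: "u \<in> ell2" for u
    unfolding power_sum_def
  proof (rule infsum_le_finite_sums[OF powr_summable[OF u s]])
    fix F :: "(int ^ 'd) set"
    assume "finite F"
    define F0 where "F0 = {n \<in> F. u n \<noteq> 0}"
    \<comment> \<open>Sites are grouped by the dyadic shell of their modulus. The shell above
      \<open>2 powr i\<close> is charged to the layer just below it, where the truncation is already
      saturated on the shell.\<close>
    define j where "j n = \<lfloor>log 2 (cmod (u n))\<rfloor>" for n
    define E where "E = D * mass u powr (\<gamma> / real CARD('d))"
    have E: "0 \<le> E"
      using D by (simp add: E_def)
    have F0: "finite F0"
      using \<open>finite F\<close> by (simp add: F0_def)
    have j: "2 powr (j n) \<le> cmod (u n)" "cmod (u n) \<le> 2 * 2 powr (j n)" if "n \<in> F0" for n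
      using floor_log_eq_powr_iff[of "cmod (u n)" 2 "j n"] that
      by (auto simp: F0_def j_def powr_add)
    have "(\<Sum>n\<in>F. cmod (u n) powr s) = (\<Sum>n\<in>F0. cmod (u n) powr s)"
      using \<open>finite F\<close> by (intro sum.mono_neutral_right) (auto simp: F0_def)
    also have "\<dots> = (\<Sum>i\<in>j ` F0. \<Sum>n\<in>{n. n \<in> F0 \<and> j n = i}. cmod (u n) powr s)"
      by (rule sum.image_gen[OF F0])
    also have "\<dots> \<le> (\<Sum>i\<in>j ` F0. 2 powr s * (E * dirichlet J (\<lambda>n. of_real (truncate (2 powr i) (cmod (u n))))))"
    proof (rule sum_mono)
      fix i
      let ?F = "{n. n \<in> F0 \<and> j n = i}"
      have "(\<Sum>n\<in>?F. cmod (u n) powr s) \<le> (\<Sum>n\<in>?F. (2 * 2 powr i) powr s)"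
        using j s by (intro sum_mono powr_mono2) auto
      also have "\<dots> = 2 powr s * (real (card ?F) * (2 powr i) powr s)"
        by (simp add: powr_mult)
      also have "real (card ?F) * (2 powr i) powr s \<le> E * dirichlet J (\<lambda>n. of_real (truncate (2 powr i) (cmod (u n))))"
        unfolding E_def using j(1) F0 by (intro level u) auto
      finally show "(\<Sum>n\<in>?F. cmod (u n) powr s)
          \<le> 2 powr s * (E * dirichlet J (\<lambda>n. of_real (truncate (2 powr i) (cmod (u n)))))"
        by simp
    qed
    also have "\<dots> = 2 powr s * E * (\<Sum>i\<in>j ` F0. dirichlet J (\<lambda>n. of_real (truncate (2 powr i) (cmod (u n)))))"
      by (simp add: sum_distrib_left mult.assoc)
    also have "\<dots> \<le> 2 powr s * E * dirichlet J u"
      using F0 E by (intro mult_left_mono sum_dirichlet_truncate_le u) auto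
    finally show "(\<Sum>n\<in>F. cmod (u n) powr s)
        \<le> 2 powr s * D * mass u powr (\<gamma> / real CARD('d)) * dirichlet J u"
      by (simp add: E_def mult.assoc)
  qed
  then show thesis
    using D by (intro that[of "2 powr s * D"]) (auto simp: s_def)
qed

text \<open>Raising the exponent above the critical one costs only a power of the supremum, hence of
  the mass, so a lower bound on \<open>p\<close> is all that is asked.\<close>

lemma gagliardo_nirenberg:
  fixes \<gamma> C :: real and K0 :: nat
  assumes avg: "\<And>K. K0 \<le> K \<Longrightarrow> averaging J \<gamma> C K" and \<gamma>: "0 \<le> \<gamma>" and C: "0 \<le> C"
    and p_ge: "1 + 2 * \<gamma> / real CARD('d) \<le> p"
  obtains D where "0 < D"
    "\<And>u. u \<in> ell2 \<Longrightarrow> power_sum (p + 1) u \<le> D * mass u powr ((p - 1) / 2) * dirichlet J u"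
proof -
  define s where "s = 2 + 2 * \<gamma> / real CARD('d)"
  have s: "2 \<le> s" "s \<le> p + 1"
    using \<gamma> p_ge by (simp_all add: s_def)
  obtain D where D: "0 < D" and GN:
    "\<And>u. u \<in> ell2 \<Longrightarrow> power_sum s u \<le> D * mass u powr (\<gamma> / real CARD('d)) * dirichlet J u"
    using gagliardo_nirenberg_critical[OF avg \<gamma> C] unfolding s_def by metis
  have "power_sum (p + 1) u \<le> D * mass u powr ((p - 1) / 2) * dirichlet J u" if u: "u \<in> ell2" for u
  proof -
    let ?E = "mass u powr ((p + 1 - s) / 2)"
    have "cmod (u n) powr (p + 1) \<le> ?E * cmod (u n) powr s" for n
    proof -
      have "cmod (u n) powr (p + 1) = cmod (u n) powr (p + 1 - s) * cmod (u n) powr s"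
        by (simp flip: powr_add)
      also have "\<dots> \<le> sqrt (mass u) powr (p + 1 - s) * cmod (u n) powr s"
        using s cmod_le_sqrt_mass[OF u] by (intro mult_right_mono powr_mono2) auto
      finally show ?thesis
        using mass_nonneg[of u] by (simp add: powr_half_sqrt[symmetric] powr_powr)
    qed
    then have "power_sum (p + 1) u \<le> (\<Sum>\<^sub>\<infinity>n. ?E * cmod (u n) powr s)"
      unfolding power_sum_def using s p
      by (intro infsum_mono summable_on_cmult_right powr_summable u) auto
    also have "\<dots> = ?E * power_sum s u"
      by (simp add: power_sum_def infsum_cmult_right')
    also have "\<dots> \<le> ?E * (D * mass u powr (\<gamma> / real CARD('d)) * dirichlet J u)"
      by (intro mult_left_mono GN u) auto
    also have "\<dots> = D * (?E * mass u powr (\<gamma> / real CARD('d))) * dirichlet J u"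
      by (simp add: mult_ac)
    also have "?E * mass u powr (\<gamma> / real CARD('d)) = mass u powr ((p - 1) / 2)"
      unfolding powr_add[symmetric] by (simp add: s_def diff_divide_distrib add_divide_distrib)
    finally show ?thesis .
  qed
  then show thesis
    using D that by blast
qed

section \<open>The excitation threshold\<close>

lemma mem_threshold_set_iff:
  "\<nu> \<in> threshold_set J p \<longleftrightarrow> 0 < \<nu> \<and> (\<forall>q\<in>ell2.
    power_sum (p + 1) q \<le> (p + 1) / 2 * \<nu> powr (- (p - 1) / 2) * mass q powr ((p - 1) / 2) * dirichlet J q)"
  using p by (simp add: threshold_set_def lp_norm_powr lp_norm_2_powr lattice_form_eq
      symmetric_kernel_axioms J_0)

text \<open>One fixed nonzero function bounds every member, since
  \<open>\<nu> powr (- (p - 1) / 2)\<close> decreases to 0. Boundedness makes the real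
  \<open>Sup\<close> meaningful.\<close>

lemma threshold_set_bdd_above: "bdd_above (threshold_set J p)"
proof -
  obtain u :: "int ^ 'd \<Rightarrow> complex" where u: "u \<in> ell2" "0 < mass u"
    using dirichlet_arbitrarily_small[of 1] by (metis zero_less_one)
  obtain n where "u n \<noteq> 0"
    using u(2) by (fastforce simp: mass_eq)
  then have N: "0 < power_sum (p + 1) u"
    using p by (intro power_sum_pos u(1)) auto
  define c where "c = (p + 1) / 2 * mass u powr ((p - 1) / 2) * dirichlet J u / power_sum (p + 1) u"
  have "\<nu> \<le> c powr (2 / (p - 1))" if "\<nu> \<in> threshold_set J p" for \<nu>
  proof -
    have \<nu>: "0 < \<nu>"
      and le: "power_sum (p + 1) u \<le> (p + 1) / 2 * \<nu> powr (- (p - 1) / 2) * mass u powr ((p - 1) / 2) * dirichlet J u"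
      using that u(1) by (auto simp: mem_threshold_set_iff)
    have "\<nu> powr (- (p - 1) / 2) = 1 / \<nu> powr ((p - 1) / 2)"
      by (simp only: minus_divide_left[symmetric] powr_minus_divide)
    then have "power_sum (p + 1) u \<le> (p + 1) / 2 * mass u powr ((p - 1) / 2) * dirichlet J u / \<nu> powr ((p - 1) / 2)"
      using le by (simp add: mult_ac)
    then have "\<nu> powr ((p - 1) / 2) * power_sum (p + 1) u \<le> (p + 1) / 2 * mass u powr ((p - 1) / 2) * dirichlet J u"
      using \<nu> by (subst (asm) pos_le_divide_eq) (simp_all add: mult.commute)
    then have "\<nu> powr ((p - 1) / 2) \<le> c"
      unfolding c_def using N by (subst pos_le_divide_eq)
    then have "(\<nu> powr ((p - 1) / 2)) powr (2 / (p - 1)) \<le> c powr (2 / (p - 1))"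
      using p by (intro powr_mono2) auto
    moreover have "(p - 1) / 2 * (2 / (p - 1)) = 1"
      using p by simp
    ultimately show ?thesis
      using \<nu> by (simp only: powr_powr powr_one less_imp_le)
  qed
  then show ?thesis
    by (rule bdd_aboveI)
qed

lemma threshold_le_excitation_threshold:
  "\<nu> \<in> threshold_set J p \<Longrightarrow> \<nu> \<le> excitation_threshold J p"
  unfolding excitation_threshold_def by (auto intro: cSup_upper threshold_set_bdd_above)

lemma excitation_threshold_nonneg: "0 \<le> excitation_threshold J p"
proof (cases "threshold_set J p = {}")
  case False
  then obtain \<nu> where "\<nu> \<in> threshold_set J p" by blast
  then show ?thesis
    using threshold_le_excitation_threshold[of \<nu>] by (simp add: mem_threshold_set_iff)
qed (simp add: excitation_threshold_def)

lemma excitation_threshold_pos: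
  assumes D: "0 < D"
    and GN: "\<And>u. u \<in> ell2 \<Longrightarrow> power_sum (p + 1) u \<le> D * mass u powr ((p - 1) / 2) * dirichlet J u"
  shows "0 < excitation_threshold J p"
proof -
  \<comment> \<open>The solution of
    \<open>(p + 1) / 2 * \<nu> powr (- (p - 1) / 2) = D\<close>.\<close>
  define \<nu> where "\<nu> = (2 * D / (p + 1)) powr (- 2 / (p - 1))"
  have \<nu>: "0 < \<nu>"
    using D p by (simp add: \<nu>_def)
  have "(- 2 / (p - 1)) * (- (p - 1) / 2) = 1"
    using p by (simp add: field_simps)
  then have "\<nu> powr (- (p - 1) / 2) = 2 * D / (p + 1)"
    unfolding \<nu>_def powr_powr using D p by simp
  then have "(p + 1) / 2 * \<nu> powr (- (p - 1) / 2) = D"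
    using p by simp
  then have "\<nu> \<in> threshold_set J p"
    unfolding mem_threshold_set_iff using GN \<nu> by simp
  then show ?thesis
    using threshold_le_excitation_threshold \<nu> by fastforce
qed

text \<open>For a nonzero \<open>q\<close> rescaled to mass \<open>\<nu>\<close>, nonnegativity of
  the energy is equivalent to the defining inequality at \<open>q\<close>, by homogeneity.\<close>

lemma ground_energy_neg:
  assumes "excitation_threshold J p < \<nu>"
  shows "ground_energy J p \<nu> < 0"
proof -
  have \<nu>: "0 < \<nu>"
    using assms excitation_threshold_nonneg by linarith
  have "\<nu> \<notin> threshold_set J p"
    using assms threshold_le_excitation_threshold by fastforce
  then obtain q where q: "q \<in> ell2"
    and less: "(p + 1) / 2 * \<nu> powr (- (p - 1) / 2) * mass q powr ((p - 1) / 2) * dirichlet J q < power_sum (p + 1) q"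
    using \<nu> by (auto simp: mem_threshold_set_iff not_le)
  \<comment> \<open>The violated inequality is strict with a nonnegative smaller side, so
    \<open>q\<close> is nonzero and can be rescaled.\<close>
  have "0 \<le> (p + 1) / 2 * \<nu> powr (- (p - 1) / 2) * mass q powr ((p - 1) / 2) * dirichlet J q"
    using p dirichlet_nonneg by simp
  also note less
  also have "power_sum (p + 1) q \<le> mass q powr ((p + 1) / 2)"
    using p by (intro power_sum_le_mass q) auto
  finally have "0 < mass q powr ((p + 1) / 2)" .
  then have M: "0 < mass q"
    using mass_nonneg[of q] by (cases "mass q = 0") auto
  define t where "t = \<nu> / mass q"
  have t: "0 < t"
    using \<nu> M by (simp add: t_def)
  have "mass q powr ((p - 1) / 2) = 1 / t powr ((p - 1) / 2) * \<nu> powr ((p - 1) / 2)"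
    using \<nu> M by (simp add: t_def powr_divide)
  moreover have "\<nu> powr (- (p - 1) / 2) = 1 / \<nu> powr ((p - 1) / 2)"
    by (simp only: minus_divide_left[symmetric] powr_minus_divide)
  ultimately have "\<nu> powr (- (p - 1) / 2) * mass q powr ((p - 1) / 2) = 1 / t powr ((p - 1) / 2)"
    using \<nu> by simp
  then have "(p + 1) / 2 * (1 / t powr ((p - 1) / 2)) * dirichlet J q < power_sum (p + 1) q"
    using less by (simp only: mult.assoc)
  then have "(p + 1) / 2 * dirichlet J q / t powr ((p - 1) / 2) < power_sum (p + 1) q"
    by simp
  then have "(p + 1) / 2 * dirichlet J q < t powr ((p - 1) / 2) * power_sum (p + 1) q"
    using t by (subst (asm) pos_divide_less_eq) (simp_all add: mult.commute)
  then have "dirichlet J q / 2 < t powr ((p - 1) / 2) * power_sum (p + 1) q / (p + 1)"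
    using p by (simp add: field_simps)
  then have "t * (dirichlet J q / 2) < t * (t powr ((p - 1) / 2) * power_sum (p + 1) q / (p + 1))"
    using t by (intro mult_strict_left_mono)
  moreover have "t * t powr ((p - 1) / 2) = t powr ((p + 1) / 2)"
    using t by (simp add: powr_mult_base field_simps)
  then have "t * (t powr ((p - 1) / 2) * power_sum (p + 1) q / (p + 1)) = t powr ((p + 1) / 2) * power_sum (p + 1) q / (p + 1)"
    by (simp flip: mult.assoc)
  moreover have "t * energy J p q - (t powr ((p + 1) / 2) - t) * power_sum (p + 1) q / (p + 1)
      = t * (dirichlet J q / 2) - t powr ((p + 1) / 2) * power_sum (p + 1) q / (p + 1)"
    by (simp add: energy_eq q left_diff_distrib right_diff_distrib diff_divide_distrib)
  ultimately show ?thesis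
    using energy_scaling[OF q M less_imp_le[OF \<nu>]] by (simp add: t_def)
qed

text \<open>If the form vanished, so would all unit increments and, along paths, all increments.
  Then \<open>u\<close> would be a nonzero constant, which has infinite mass on the lattice.\<close>

lemma dirichlet_pos:
  assumes J: "\<And>e. l1_norm e = 1 \<Longrightarrow> 0 < J e" and u: "u \<in> ell2" "0 < mass u"
  shows "0 < dirichlet J u"
proof (rule ccontr)
  assume "\<not> 0 < dirichlet J u"
  then have Q: "dirichlet J u \<le> 0"
    by simp
  have "incr u e \<le> 0" if "l1_norm e = 1" for e
  proof -
    have "J e * incr u e \<le> 0"
      using sum_incr_le_dirichlet[OF u(1), of "{e}"] Q by simp
    then show ?thesis
      using J[OF that] by (simp add: mult_le_0_iff)
  qed
  from incr_le_l1_norm_sq[OF u(1) this] have incr: "incr u h \<le> 0" for h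
    by simp
  obtain n where n: "u n \<noteq> 0"
    using u(2) by (fastforce simp: mass_eq)
  define c where "c = u n"
  \<comment> \<open>Only the term at \<open>n\<close> of the vanishing increment for the jump
    \<open>m - n\<close> is looked at.\<close>
  have const: "u m = c" for m
    using order_trans[OF norm_sq_le_mass[OF ell2_incr[OF u(1)], of n "m - n"] incr[of "m - n", unfolded incr_def]]
    by (simp add: c_def)
  obtain K where K: "mass u / (cmod c)\<^sup>2 < real K"
    using reals_Archimedean2 by blast
  have "real K * (cmod c)\<^sup>2 \<le> real (card (cube K :: (int ^ 'd) set)) * (cmod c)\<^sup>2"
    using self_le_power[of "2 * K + 1" "CARD('d)"]
    by (intro mult_right_mono of_nat_mono) (auto simp: card_cube Suc_le_eq)
  also have "\<dots> = (\<Sum>m\<in>cube K. (cmod (u m))\<^sup>2)"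
    by (simp add: const)
  also have "\<dots> \<le> mass u"
    by (rule sum_norm_sq_le_mass[OF u(1) finite_cube])
  finally have "real K \<le> mass u / (cmod c)\<^sup>2"
    using n by (simp add: pos_le_divide_eq c_def)
  then show False
    using K by simp
qed

text \<open>Some member \<open>\<mu>\<close> of the threshold set lies strictly above
  \<open>\<nu>\<close>. The gap gives a factor below 1, and together with positivity of the
  Dirichlet form it makes the inequality strict, which is what rules out minimizers of energy
  0.\<close>

lemma energy_pos_below_threshold:
  assumes J: "\<And>e. l1_norm e = 1 \<Longrightarrow> 0 < J e" and \<nu>: "0 < \<nu>" "\<nu> < excitation_threshold J p"
    and q: "q \<in> ell2" "mass q = \<nu>"
  shows "0 < energy J p q"
proof -
  have ne: "threshold_set J p \<noteq> {}"
    using \<nu> by (auto simp: excitation_threshold_def)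
  then obtain \<mu> where \<mu>: "\<mu> \<in> threshold_set J p" "\<nu> < \<mu>"
    using \<nu>(2) less_cSup_iff[OF ne threshold_set_bdd_above] by (auto simp: excitation_threshold_def)
  define r where "r = \<mu> powr (- (p - 1) / 2) * \<nu> powr ((p - 1) / 2)"
  have Q: "0 < dirichlet J q"
    using q \<nu> by (intro dirichlet_pos J) auto
  have "\<nu> powr ((p - 1) / 2) < \<mu> powr ((p - 1) / 2)"
    using \<mu> \<nu> p by (intro powr_less_mono2) auto
  moreover have "\<mu> powr (- (p - 1) / 2) = 1 / \<mu> powr ((p - 1) / 2)"
    by (simp only: minus_divide_left[symmetric] powr_minus_divide)
  ultimately have r: "r < 1"
    using \<mu> \<nu> by (simp add: r_def)
  have "power_sum (p + 1) q \<le> (p + 1) / 2 * \<mu> powr (- (p - 1) / 2) * mass q powr ((p - 1) / 2) * dirichlet J q"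
    using \<mu>(1) q(1) unfolding mem_threshold_set_iff by blast
  also have "\<dots> = (p + 1) / 2 * (r * dirichlet J q)"
    by (simp add: r_def q(2))
  also have "\<dots> < (p + 1) / 2 * dirichlet J q"
    using r Q p by (intro mult_strict_left_mono) auto
  finally show ?thesis
    using p by (simp add: energy_eq q(1) field_simps)
qed

lemma ground_energy_eq_0:
  assumes J: "\<And>e. l1_norm e = 1 \<Longrightarrow> 0 < J e" and \<nu>: "0 < \<nu>" "\<nu> < excitation_threshold J p"
  shows "ground_energy J p \<nu> = 0" "\<not> (\<exists>q. is_minimizer J p \<nu> q)"
proof -
  have pos: "0 < energy J p q" if "q \<in> ell2" "mass q = \<nu>" for q
    using energy_pos_below_threshold[OF J \<nu> that] by blast
  have "0 \<le> ground_energy J p \<nu>"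
    unfolding ground_energy_def
    using ground_energy_set_nonempty[of \<nu>] \<nu> pos by (intro cInf_greatest) (auto intro: less_imp_le)
  then show "ground_energy J p \<nu> = 0"
    using ground_energy_nonpos[OF \<nu>(1)] by simp
  then show "\<not> (\<exists>q. is_minimizer J p \<nu> q)"
    using pos by (fastforce simp: is_minimizer_def)
qed

end

text \<open>The exponent \<open>2 * alpha_prime \<alpha>\<close> is \<alpha> for \<alpha> < 2, where
  long jumps do the averaging, and 2 otherwise, where paths of unit jumps do it.\<close>

lemma admissible_kernel_averaging:
  fixes J :: "int ^ 'd::finite \<Rightarrow> real"
  assumes lk: "lattice_kernel J p" and adm: "admissible_kernel \<alpha> J"
  obtains C :: real and K0 :: nat
  where "0 \<le> C" "\<And>K. K0 \<le> K \<Longrightarrow> averaging J (2 * alpha_prime \<alpha>) C K"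
proof (cases "\<alpha> < 2")
  case False
  interpret lattice_kernel J p by fact
  define c where "c = Min (J ` l1_sphere 1)"
  have c: "0 < c"
    using adm by (simp add: admissible_kernel_def c_def)
  have J: "c \<le> J e" if "l1_norm e = 1" for e
    unfolding c_def using that by (intro Min_le) (auto simp: finite_l1_sphere, auto simp: l1_sphere_def)
  show thesis
    using False averaging_nearest_neighbour[OF c J]
    by (intro that[of "max 1 (2 * (real CARD('d))\<^sup>2 / c)" 1]) (auto simp: alpha_prime_def)
next
  case True
  interpret lattice_kernel J p by fact
  have "0 < \<alpha>"
    using adm by (simp add: admissible_kernel_def)
  with True obtain a where a: "\<alpha> = ereal a" "0 < a"
    by (cases \<alpha>) auto
  have "\<exists>\<eta> :: nat \<Rightarrow> real.
      (\<exists>C1 C2 k0. 0 < C1 \<and> C1 < C2 \<and> (\<forall>k\<ge>k0. C1 \<le> real k powr (real CARD('d) + a) * \<eta> k \<and>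
        real k powr (real CARD('d) + a) * \<eta> k \<le> C2)) \<and>
      (\<exists>R cp cm :: real. 0 < R \<and> 0 < cp \<and> 0 < cm \<and>
        (\<forall>n. R \<le> real (l1_norm n) \<longrightarrow> J n \<le> cp * \<eta> (l1_norm n)) \<and>
        (\<forall>k. R \<le> real k \<longrightarrow> cm * real k ^ (CARD('d) - 1) * \<eta> k \<le> (\<Sum>m\<in>l1_sphere k. J m)))"
    using adm unfolding admissible_kernel_def a less_ereal.simps real_of_ereal.simps by blast
  then obtain \<eta> :: "nat \<Rightarrow> real" and C1 C2 k0 R cp cm where const: "0 < C1" "C1 < C2" "0 < cp" "0 < cm"
    and \<eta>: "\<And>k. k0 \<le> k \<Longrightarrow> C1 \<le> real k powr (real CARD('d) + a) * \<eta> k"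
      "\<And>k. k0 \<le> k \<Longrightarrow> real k powr (real CARD('d) + a) * \<eta> k \<le> C2"
    and JR: "\<And>n. R \<le> real (l1_norm n) \<Longrightarrow> J n \<le> cp * \<eta> (l1_norm n)"
      "\<And>k. R \<le> real k \<Longrightarrow> cm * real k ^ (CARD('d) - 1) * \<eta> k \<le> (\<Sum>m\<in>l1_sphere k. J m)"
    by metis
  define K0 where "K0 = max 1 (max k0 (nat \<lceil>R\<rceil>))"
  have "averaging J a ((cp * C2 + 2) / (cm * C1 / 2 powr (1 + a))) K" if K: "K0 \<le> K" for K
  proof (rule averaging_heavy_tail)
    have *: "k0 \<le> k \<and> R \<le> real k" if "K \<le> k" for k
      using K that unfolding K0_def by linarith
    show "C1 \<le> real k powr (real CARD('d) + a) * \<eta> k" "real k powr (real CARD('d) + a) * \<eta> k \<le> C2"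
      "cm * real k ^ (CARD('d) - 1) * \<eta> k \<le> (\<Sum>m\<in>l1_sphere k. J m)" if "K \<le> k" for k
      using *[OF that] \<eta> JR(2) by auto
    show "J n \<le> cp * \<eta> (l1_norm n)" if "K \<le> l1_norm n" for n
      using *[OF that] JR(1) by auto
    show "1 \<le> K"
      using K by (simp add: K0_def)
  qed (use const a in auto)
  then show thesis
    using const a True by (intro that[of "(cp * C2 + 2) / (cm * C1 / 2 powr (1 + a))" K0])
      (auto simp: alpha_prime_def)
qed

theorem proposition3p3:
  fixes J :: "int ^ 'd::finite \<Rightarrow> real" and p :: real and \<alpha> :: ereal
  assumes "1 < p" and "admissible_kernel \<alpha> J"
  shows "(1 + 4 * alpha_prime \<alpha> / real CARD('d) \<le> p \<longrightarrow> 0 < excitation_threshold J p) \<and>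
         (\<forall>\<nu>. excitation_threshold J p < \<nu> \<longrightarrow>
            ground_energy J p \<nu> < 0 \<and> (\<exists>q. is_minimizer J p \<nu> q)) \<and>
         (\<forall>\<nu>. 0 < \<nu> \<and> \<nu> < excitation_threshold J p \<longrightarrow>
            ground_energy J p \<nu> = 0 \<and> \<not> (\<exists>q. is_minimizer J p \<nu> q))"
proof -
  interpret lattice_kernel J p
    using assms by unfold_locales (auto simp: admissible_kernel_def)
  have J: "0 < J e" if "l1_norm e = 1" for e
  proof -
    have "Min (J ` l1_sphere 1) \<le> J e"
      using that by (intro Min_le) (auto simp: finite_l1_sphere, auto simp: l1_sphere_def)
    then show ?thesis
      using assms(2) by (simp add: admissible_kernel_def)
  qed
  have "0 < excitation_threshold J p" if p': "1 + 4 * alpha_prime \<alpha> / real CARD('d) \<le> p"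
  proof -
    obtain C K0 where C: "0 \<le> C" "\<And>K. K0 \<le> K \<Longrightarrow> averaging J (2 * alpha_prime \<alpha>) C K"
      using admissible_kernel_averaging[OF lattice_kernel_axioms assms(2)] by blast
    have "0 < \<alpha>"
      using assms(2) by (simp add: admissible_kernel_def)
    then have "0 \<le> 2 * alpha_prime \<alpha>"
      by (cases \<alpha>) (auto simp: alpha_prime_def)
    moreover have "1 + 2 * (2 * alpha_prime \<alpha>) / real CARD('d) \<le> p"
      using p' by simp
    ultimately obtain D where "0 < D"
      "\<And>u. u \<in> ell2 \<Longrightarrow> power_sum (p + 1) u \<le> D * mass u powr ((p - 1) / 2) * dirichlet J u"
      using gagliardo_nirenberg[OF C(2) _ C(1)] by metis
    then show ?thesis
      by (rule excitation_threshold_pos)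
  qed
  moreover have "ground_energy J p \<nu> < 0 \<and> (\<exists>q. is_minimizer J p \<nu> q)"
    if "excitation_threshold J p < \<nu>" for \<nu>
    using ground_energy_neg[OF that] exists_minimizer[of \<nu>] that excitation_threshold_nonneg by fastforce
  moreover have "ground_energy J p \<nu> = 0 \<and> \<not> (\<exists>q. is_minimizer J p \<nu> q)"
    if "0 < \<nu>" "\<nu> < excitation_threshold J p" for \<nu>
    using ground_energy_eq_0[OF J that] by blast
  ultimately show ?thesis
    by blast
qed

end
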